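(* Let $d\ge 2$, let $\ell\in\mathbb{S}^{d-1}$, let $\{\lambda_n\}_{n\ge 0}$ be a sequence of positive real numbers, and let $X=\{X_n\}_{n\ge 0}$ be a $\lambda_n$-GERW in direction $\ell$ with excitation set $A\supset\mathbb{M}_\ell$, where $\mathbb{M}_\ell=\{x\in\mathbb{Z}^d: x\cdot\ell>0\}$. There exists $\beta_0\in(0,1/6)$ such that if for some $n_0\in\mathbb{N}$, $\lambda>0$ and $\beta<\beta_0$ we have $\lambda_n\ge\lambda(n_0+n)^{-\beta}$ for every $n\ge 1$, then $$\mathbb{P}\Big(\lim_{n\to\infty}X_n\cdot\ell=\infty\Big)>0.$$
   Context: $\|\cdot\|$ is the Euclidean norm on $\mathbb{R}^d$ and $\mathbb{S}^{d-1}$ is the unit sphere of $\mathbb{R}^d$. Definition (GERW). Let $d\ge2$, $\ell\in\mathbb{S}^{d-1}$, let $\{\lambda_n\}_{n\ge0}$ be a sequence of positive real numbers and let $A\subset\mathbb{Z}^d$ be nonempty. Let $X=\{X_n\}_{n\ge0}$ be a $\mathbb{Z}^d$-valued adapted process on a stochastic basis $(\Omega,\mathcal{F},\mathbb{P},\{\mathcal{F}_n\}_{n\ge0})$, where $\mathcal{F}_0$ contains all the $\mathbb{P}$-null sets of $\mathcal{F}$, with $X_0=0$; $\mathbb{E}$ denotes expectation with respect to $\mathbb{P}$. $X$ is called a $\lambda_n$-GERW (generalized excited random walk) in direction $\ell$ with excitation set $A$ if the following three conditions hold: 1. (Bounded increments) There exists a positive constant $K$ such that $\sup_{n\ge0}\|X_{n+1}-X_n\|<K$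 on every realization. 2. (Drift) Almost surely: on the event $\{X_k\ne X_n\ \forall k<n\}\cap\{X_n\in A\}$ one has $\mathbb{E}[X_{n+1}-X_n\mid\mathcal{F}_n]\cdot\ell\ge\lambda_n$; on the event $\{\exists k<n \text{ such that } X_k=X_n\}$ or $\{X_k\neq X_n\ \forall k<n\}\cap\{X_n\notin A\}$ one has $\mathbb{E}[X_{n+1}-X_n\mid\mathcal{F}_n]=0$. 3. (Uniform ellipticity) There exist $h,r>0$ such that: for all $n$, $\mathbb{P}[(X_{n+1}-X_n)\cdot\ell>r\mid\mathcal{F}_n]\ge h$ a.s.; and, on the event $\{\mathbb{E}[X_{n+1}-X_n\mid\mathcal{F}_n]=0\}$, for all $\ell'\in\mathbb{S}^{d-1}$, $\mathbb{P}[(X_{n+1}-X_n)\cdot\ell'>r\mid\mathcal{F}_n]\ge h$ a.s. *)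

theory Defs
  imports "HOL-Probability.Probability"
begin

definition int_lattice :: "(real ^ 'd) set" where
  "int_lattice = {x. \<forall>i. x $ i \<in> \<int>}"

definition halfspace_lattice :: "real ^ 'd \<Rightarrow> (real ^ 'd) set" where
  "halfspace_lattice l = {x \<in> int_lattice. x \<bullet> l > 0}"

locale stochastic_basis = prob_space M + filtration "space M" F
  for M :: "'a measure" and F :: "nat \<Rightarrow> 'a measure" +
  assumes sets_F_subset: "\<And>n. sets (F n) \<subseteq> sets M"
    and null_sets_F0: "null_sets M \<subseteq> sets (F 0)"

text \<open>The conditional expectation of an \<open>\<real>\<^sup>d\<close>-valued random variable is taken componentwise.\<close>

definition vec_cond_exp ::
    "'a measure \<Rightarrow> 'a measure \<Rightarrow> ('a \<Rightarrow> real ^ 'd) \<Rightarrow> 'a \<Rightarrow> real ^ 'd" where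
  "vec_cond_exp M G Y \<omega> = (\<chi> i. real_cond_exp M G (\<lambda>\<omega>'. Y \<omega>' $ i) \<omega>)"

definition cond_probability :: "'a measure \<Rightarrow> 'a measure \<Rightarrow> ('a \<Rightarrow> bool) \<Rightarrow> 'a \<Rightarrow> real" where
  "cond_probability M G P = real_cond_exp M G (indicator {\<omega> \<in> space M. P \<omega>})"

definition first_visit :: "(nat \<Rightarrow> 'a \<Rightarrow> 'b) \<Rightarrow> nat \<Rightarrow> 'a \<Rightarrow> bool" where
  "first_visit X n \<omega> \<longleftrightarrow> (\<forall>k<n. X k \<omega> \<noteq> X n \<omega>)"

text \<open>
  Generalized excited random walk in direction \<open>l\<close> with excitation set \<open>A\<close>. The constants \<open>K\<close>
  (bounded increments) and \<open>h\<close>, \<open>r\<close> (uniform ellipticity) are parameters instead of being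
  quantified existentially, so that other quantities can be chosen depending on them only: a
  process is a \<open>lam\<close>-GERW iff the predicate holds for some \<open>K\<close>, \<open>h\<close>, \<open>r\<close>.

  The supremum of the increments is taken in the extended reals, because the supremum of an
  unbounded set of reals is unspecified. In \<open>ellipticity_all\<close> the exceptional null set may depend on
  the direction \<open>l'\<close>.
\<close>

locale GERW = stochastic_basis M F
  for M :: "'a measure" and F :: "nat \<Rightarrow> 'a measure" +
  fixes l :: "real ^ 'd" and lam :: "nat \<Rightarrow> real" and A :: "(real ^ 'd) set"
    and K h r :: real and X :: "nat \<Rightarrow> 'a \<Rightarrow> real ^ 'd"
  assumes dimension: "CARD('d) \<ge> 2"
    and direction: "norm l = 1"
    and lam_pos: "\<And>n. lam n > 0"
    and excitation_set: "A \<subseteq> int_lattice" "A \<noteq> {}"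
    and adapted: "\<And>n. X n \<in> borel_measurable (F n)"
    and lattice_valued: "\<And>n \<omega>. \<omega> \<in> space M \<Longrightarrow> X n \<omega> \<in> int_lattice"
    and start: "\<And>\<omega>. \<omega> \<in> space M \<Longrightarrow> X 0 \<omega> = 0"
    and K_pos: "K > 0"
    and bounded_increments:
      "\<And>\<omega>. \<omega> \<in> space M \<Longrightarrow> (SUP n. ereal (norm (X (Suc n) \<omega> - X n \<omega>))) < ereal K"
    and drift: "AE \<omega> in M. \<forall>n. first_visit X n \<omega> \<and> X n \<omega> \<in> A \<longrightarrow>
      vec_cond_exp M (F n) (\<lambda>\<omega>. X (Suc n) \<omega> - X n \<omega>) \<omega> \<bullet> l \<ge> lam n"
    and no_drift: "AE \<omega> in M. \<forall>n.
      \<not> first_visit X n \<omega> \<or> (first_visit X n \<omega> \<and> X n \<omega> \<notin> A) \<longrightarrow>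
      vec_cond_exp M (F n) (\<lambda>\<omega>. X (Suc n) \<omega> - X n \<omega>) \<omega> = 0"
    and h_pos: "h > 0" and r_pos: "r > 0"
    and ellipticity_direction: "\<And>n. AE \<omega> in M.
      cond_probability M (F n) (\<lambda>\<omega>. (X (Suc n) \<omega> - X n \<omega>) \<bullet> l > r) \<omega> \<ge> h"
    and ellipticity_all: "\<And>n l'. norm l' = 1 \<Longrightarrow> AE \<omega> in M.
      vec_cond_exp M (F n) (\<lambda>\<omega>. X (Suc n) \<omega> - X n \<omega>) \<omega> = 0 \<longrightarrow>
      cond_probability M (F n) (\<lambda>\<omega>. (X (Suc n) \<omega> - X n \<omega>) \<bullet> l' > r) \<omega> \<ge> h"

end

theory Submission
  imports Defs
begin

text \<open>
  In the zero-drift steps the function \<open>(R\<^sup>2 + \<parallel>x\<parallel>\<^sup>2) powr p\<close> with \<open>p\<close> slightly below \<open>1/2\<close> is a strict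
  submartingale by ellipticity in dimension at least 2, so a zero-drift walk returns to a site only about
  \<open>m powr p\<close> times within \<open>m\<close> steps. A first visit at distance \<open>\<rho>\<close> costs at most a constant times
  \<open>\<rho> powr (2p - 1)\<close>, whatever the drift is, and since distinct first visits happen at distinct lattice
  points, the total cost of \<open>N\<close> of them is \<open>O(N powr (1 - \<theta>))\<close>. Hence, as long as fewer than
  \<open>N \<approx> m powr (1/2 + \<alpha>)\<close> new sites have been found, the expected number of self-intersections
  is small, whereas by Cauchy-Schwarz a small range forces many self-intersections. Thus \<open>m\<close> steps produce
  \<open>m powr (1/2 + \<alpha>)\<close> new sites outside an event of probability \<open>O(m powr (-\<alpha>))\<close>, and dyadic \<open>m\<close> suffice.

  By uniform ellipticity the walk climbs for \<open>T\<close> steps with positive probability. After that, the drift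
  collected in \<open>m\<close> steps spent in the half-space is at least of order \<open>m powr (1/2 + \<alpha> - \<beta>)\<close>, which beats the
  martingale fluctuations of order \<open>m powr (1/2 + \<alpha>/2)\<close> on all scales at once if \<open>T\<close> is large.
\<close>

section \<open>Deterministic estimates\<close>

text \<open>Three obstacles determine the form of the estimates. The climb is only known to have
  probability at least h^T, and T grows with the scale from which the walk is controlled. So the
  probability bounds after time T are stated on an event E of \<open>F T\<close>, with constants
  free of T and a factor P(E), and this factor cancels in the final union bound. Next, the gain from
  ellipticity needs a unit vector orthogonal to the current displacement, which is random, while the
  exceptional null set of ellipticity may depend on the direction. Hence the displacement is frozen
  at one lattice value at a time, and the finitely many reachable values are summed afterwards.
  Finally, \<open>\<beta>\<^sub>0\<close> has to be fixed before the process, so the exponent p and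
  the shift R come from a deterministic inequality that involves only K and h r^2 / 2.\<close>

lemma one_plus_powr_ge:
  fixes \<theta> u p :: real
  assumes th: "0 < \<theta>" "\<theta> \<le> 1/2" and p: "p = (1 - \<theta>) / 2"
    and u: "\<bar>u\<bar> \<le> \<theta> / 4"
  shows "(1 + u) powr p \<ge> 1 + p * u - p * (1 + 2 * \<theta>) / 4 * u\<^sup>2"
proof (cases "u = 0")
  case False
  \<comment> \<open>The exact second-order coefficient p (p - 1) / 2 is -p (1 + \<theta>) / 4.
    Writing 1 + 2 \<theta> instead of 1 + \<theta> leaves slack for evaluating the second derivative
    away from 0. Since f and its derivative vanish at 0, only the sign of \<open>f2\<close> at the
    Lagrange point matters.\<close>
  define f where "f = (\<lambda>x. (1 + x) powr p - 1 - p * x + p * (1 + 2 * \<theta>) / 4 * x\<^sup>2)"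
  define f1 where "f1 = (\<lambda>x. p * (1 + x) powr (p - 1) - p + p * (1 + 2 * \<theta>) / 2 * x)"
  define f2 where "f2 = (\<lambda>x. p * (p - 1) * (1 + x) powr (p - 2) + p * (1 + 2 * \<theta>) / 2)"
  define diff where "diff = (\<lambda>n::nat. if n = 0 then f else if n = 1 then f1 else f2)"
  have pow: "((\<lambda>x. (1 + x) powr a) has_real_derivative a * (1 + x) powr (a - 1)) (at x)" if "x > -1" for a x :: real
    using has_real_derivative_powr[of "1 + x" a] DERIV_shift[of "\<lambda>z. z powr a" _ x 1] that
    by (simp add: add.commute)
  have d0: "(f has_real_derivative f1 x) (at x)" if "x > -1" for x
    unfolding f_def f1_def using that by (auto intro!: derivative_eq_intros pow)
  have d1: "(f1 has_real_derivative f2 x) (at x)" if "x > -1" for x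
    unfolding f1_def f2_def using that by (auto intro!: derivative_eq_intros pow simp: algebra_simps)
  have "\<exists>t. (if u < 0 then u < t \<and> t < 0 else 0 < t \<and> t < u) \<and>
      f u = (\<Sum>m<2. diff m 0 / fact m * (u - 0) ^ m) + diff 2 t / fact 2 * (u - 0) ^ 2"
  proof (rule Taylor[where a = "-1/8" and b = "1/8"])
    show "\<forall>m t. m < 2 \<and> - 1 / 8 \<le> t \<and> t \<le> 1 / 8 \<longrightarrow> DERIV (diff m) t :> diff (Suc m) t"
    proof (intro allI impI)
      fix m :: nat and t :: real
      assume a: "m < 2 \<and> - 1 / 8 \<le> t \<and> t \<le> 1 / 8"
      then consider "m = 0" | "m = 1" by linarith
      then show "DERIV (diff m) t :> diff (Suc m) t"
        by cases (use a in \<open>auto simp: diff_def intro!: d0 d1\<close>)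
    qed
  qed (use u th False in \<open>auto simp: diff_def\<close>)
  then obtain t where t: "if u < 0 then u < t \<and> t < 0 else 0 < t \<and> t < u"
      and eq: "f u = (\<Sum>m<2. diff m 0 / fact m * (u - 0) ^ m) + diff 2 t / fact 2 * (u - 0) ^ 2"
    by blast
  have eq: "f u = f2 t / 2 * u\<^sup>2"
    using eq by (simp add: diff_def numeral_2_eq_2 f_def f1_def)
  have tb: "t \<ge> - \<theta> / 4" using t u by (auto split: if_splits)
  have "(1 + t) powr (p - 2) \<le> (1 - \<theta> / 4) powr (p - 2)"
    by (rule powr_mono2') (use th p tb in auto)
  also have "\<dots> \<le> (1 - \<theta> / 4) powr (-2)"
    by (rule powr_mono') (use th p in auto)
  also have "\<dots> = 1 / (1 - \<theta> / 4)\<^sup>2"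
    using th by (simp add: powr_minus powr_numeral field_simps)
  also have "\<dots> \<le> (1 + 2 * \<theta>) / (1 + \<theta>)"
  proof -
    have "(1 - \<theta> / 4)\<^sup>2 \<ge> 1 - \<theta> / 2" by (simp add: power2_eq_square algebra_simps)
    then have "(1 + 2 * \<theta>) * (1 - \<theta> / 4)\<^sup>2 \<ge> (1 + 2 * \<theta>) * (1 - \<theta> / 2)"
      using th by (intro mult_left_mono) auto
    \<comment> \<open>Here \<theta> \<le> 1/2 enters: it makes the remainder \<theta> (1/2 -
      \<theta>) nonnegative.\<close>
    moreover have "(1 + 2 * \<theta>) * (1 - \<theta> / 2) = 1 + \<theta> + \<theta> * (1 / 2 - \<theta>)" by (simp add: algebra_simps)
    moreover have "\<theta> * (1 / 2 - \<theta>) \<ge> 0" using th by simp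
    ultimately have "(1 + 2 * \<theta>) * (1 - \<theta> / 4)\<^sup>2 \<ge> 1 + \<theta>" by linarith
    moreover have "(1 - \<theta> / 4)\<^sup>2 > 0" using th by simp
    ultimately show ?thesis using th by (simp add: field_simps)
  qed
  finally have "(1 + \<theta>) * (1 + t) powr (p - 2) \<le> 1 + 2 * \<theta>"
    using th by (simp add: field_simps)
  moreover have "0 \<le> p" using th p by (simp add: field_simps)
  ultimately have "p * ((1 + \<theta>) * (1 + t) powr (p - 2)) \<le> p * (1 + 2 * \<theta>)"
    by (rule mult_left_mono)
  moreover have "f2 t = p * (1 + 2 * \<theta>) / 2 - p * ((1 + \<theta>) * (1 + t) powr (p - 2)) / 2"
    unfolding f2_def p by (simp add: field_simps)
  ultimately have "f2 t \<ge> 0" by simp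
  then have "f u \<ge> 0" unfolding eq by simp
  then show ?thesis by (simp add: f_def)
qed simp

text \<open>Up to small errors, the second-order term offsets |D|^2 by (y.D)^2 / s with s = R^2 +
  |y|^2. By Cauchy-Schwarz in the hyperplane orthogonal to e, this is at most |D|^2 - (e.D)^2, so
  the squared component along e survives. An exponent slightly below 1/2 costs no more than the
  error \<eta>.\<close>

lemma power_potential_step:
  fixes \<eta> K :: real
  assumes "\<eta> > 0" and "K > 0"
  obtains p R :: real where "0 < p" "p < 1/2" "R \<ge> 1"
    "\<And>y D e :: 'v :: real_inner. norm D \<le> K \<Longrightarrow> norm e = 1 \<Longrightarrow> e \<bullet> y = 0 \<Longrightarrow>
      (R\<^sup>2 + (norm (y + D))\<^sup>2) powr p - (R\<^sup>2 + (norm y)\<^sup>2) powr p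
        \<ge> p * (R\<^sup>2 + (norm y)\<^sup>2) powr (p - 1) * (2 * (y \<bullet> D) + (e \<bullet> D)\<^sup>2 - \<eta>)"
proof -
  \<comment> \<open>This \<theta> is 1 - 2p. The choices of \<open>\<theta>\<close> and
    \<open>\<epsilon>\<close> make the two errors \<open>2 * \<theta> * K\<^sup>2\<close> and
    \<open>5 * \<epsilon> * K\<^sup>2\<close> at most \<eta>/2 each. \<open>R\<close> makes K at
    most an \<epsilon> fraction of sqrt s at every y, so that the relative change |u| \<le> 3
    \<epsilon> stays in the range of the Taylor estimate.\<close>
  define \<theta> where "\<theta> = min (1/2) (\<eta> / (4 * K\<^sup>2))"
  have th: "0 < \<theta>" "\<theta> \<le> 1/2" "\<theta> \<le> \<eta> / (4 * K\<^sup>2)"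
    using assms by (auto simp: \<theta>_def min_less_iff_conj)
  define \<epsilon> where "\<epsilon> = min (\<theta> / 12) (\<eta> / (10 * K\<^sup>2))"
  have ep: "0 < \<epsilon>" "\<epsilon> \<le> \<theta> / 12" "\<epsilon> \<le> \<eta> / (10 * K\<^sup>2)"
    using assms th by (auto simp: \<epsilon>_def min_less_iff_conj)
  have ep1: "\<epsilon> \<le> 1" using ep th by simp
  define R where "R = max 1 (K / \<epsilon>)"
  have R: "R \<ge> 1" "K \<le> \<epsilon> * R"
  proof -
    have "K / \<epsilon> \<le> R" by (simp add: R_def)
    then show "K \<le> \<epsilon> * R" using ep by (simp add: field_simps)
  qed (simp add: R_def)
  define p where "p = (1 - \<theta>) / 2"
  show ?thesis
  proof (rule that[of p R])
    show "0 < p" "p < 1/2" "R \<ge> 1" using th R by (auto simp: p_def)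
    fix y D e :: 'v
    assume D: "norm D \<le> K" and e: "norm e = 1" "e \<bullet> y = 0"
    define s where "s = R\<^sup>2 + (norm y)\<^sup>2"
    define q where "q = sqrt s"
    have "R\<^sup>2 \<ge> 1" using R by (simp add: power2_eq_square mult_ge1_I)
    then have s1: "s \<ge> 1" "s > 0" unfolding s_def by (smt (verit) zero_le_power2)+
    have q: "q\<^sup>2 = s" "q \<ge> R" "q \<ge> norm y" "q \<ge> 1" "q > 0"
    proof -
      show "q\<^sup>2 = s" using s1 by (simp add: q_def)
      show a: "q \<ge> R" unfolding q_def by (rule real_le_rsqrt) (simp add: s_def)
      show "q \<ge> norm y" unfolding q_def by (rule real_le_rsqrt) (simp add: s_def)
      show "q \<ge> 1" "q > 0" using a R by auto
    qed
    define w where "w = 2 * (y \<bullet> D) + (norm D)\<^sup>2"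
    define u where "u = w / s"
    have Kq: "K \<le> \<epsilon> * q" using R q ep by (meson mult_left_mono order.trans less_imp_le)
    have yD: "\<bar>y \<bullet> D\<bar> \<le> q * K"
      using Cauchy_Schwarz_ineq2[of y D] mult_mono[OF q(3) D] q by (auto intro: order.trans)
    have D2: "(norm D)\<^sup>2 \<le> K\<^sup>2" using D by (simp add: power_mono)
    have "\<bar>w\<bar> \<le> 2 * (q * K) + K\<^sup>2" using yD D2 unfolding w_def by (smt (verit) zero_le_power2)
    also have "\<dots> \<le> 2 * (q * (\<epsilon> * q)) + \<epsilon> * q * (1 * q)"
    proof (intro add_mono mult_left_mono)
      have "K * K \<le> \<epsilon> * q * (1 * q)"
        using Kq q ep1 assms ep by (intro mult_mono) (auto intro: order.trans[OF Kq] mult_right_mono)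
      then show "K\<^sup>2 \<le> \<epsilon> * q * (1 * q)" by (simp add: power2_eq_square)
    qed (use Kq q in auto)
    also have "\<dots> = 3 * \<epsilon> * s" using q(1) by (simp add: power2_eq_square)
    finally have "\<bar>u\<bar> \<le> 3 * \<epsilon>" using s1 by (simp add: u_def abs_divide field_simps)
    then have ub: "\<bar>u\<bar> \<le> \<theta> / 4" using ep by simp
    have s': "R\<^sup>2 + (norm (y + D))\<^sup>2 = s * (1 + u)"
      using s1 unfolding u_def w_def s_def
      by (simp add: field_simps power2_norm_eq_inner inner_add_left inner_add_right inner_commute)
    have "(R\<^sup>2 + (norm (y + D))\<^sup>2) powr p = s powr p * (1 + u) powr p"
      unfolding s' using s1 ub th by (simp add: powr_mult)
    also have "\<dots> \<ge> s powr p * (1 + p * u - p * (1 + 2 * \<theta>) / 4 * u\<^sup>2)"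
      using one_plus_powr_ge[OF th(1,2) p_def ub] by (intro mult_left_mono) auto
    finally have "(R\<^sup>2 + (norm (y + D))\<^sup>2) powr p - s powr p \<ge> s powr p * (p * u - p * (1 + 2 * \<theta>) / 4 * u\<^sup>2)"
      by (simp add: algebra_simps)
    moreover have "s powr p * (p * u - p * (1 + 2 * \<theta>) / 4 * u\<^sup>2)
        = p * s powr (p - 1) * (w - (1 + 2 * \<theta>) / 4 * (w\<^sup>2 / s))"
      using s1 by (simp add: u_def powr_diff field_simps power2_eq_square)
    moreover have "w - (1 + 2 * \<theta>) / 4 * (w\<^sup>2 / s) \<ge> 2 * (y \<bullet> D) + (e \<bullet> D)\<^sup>2 - \<eta>"
    proof -
      \<comment> \<open>As e is orthogonal to y, deleting the e-component of D leaves y.D unchanged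
        but lowers the norm; Cauchy-Schwarz for D' is therefore sharper by (e.D)^2.\<close>
      define D' where "D' = D - (e \<bullet> D) *\<^sub>R e"
      have ee: "e \<bullet> e = 1" using e by (simp add: norm_eq_1)
      have D': "y \<bullet> D' = y \<bullet> D"
        using e by (simp add: D'_def inner_diff_right inner_commute)
      have D'2: "(norm D')\<^sup>2 = (norm D)\<^sup>2 - (e \<bullet> D)\<^sup>2"
        using ee unfolding D'_def power2_norm_eq_inner
        by (simp add: inner_diff_left inner_diff_right inner_commute power2_eq_square)
      have "(y \<bullet> D')\<^sup>2 \<le> (norm y * norm D')\<^sup>2"
        using Cauchy_Schwarz_ineq2[of y D'] by (meson abs_le_square_iff abs_ge_self order.trans)
      also have "\<dots> \<le> s * (norm D')\<^sup>2"
        by (simp add: power_mult_distrib s_def mult_right_mono)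
      finally have c: "(y \<bullet> D)\<^sup>2 \<le> s * ((norm D)\<^sup>2 - (e \<bullet> D)\<^sup>2)" using D' D'2 by simp
      have "w\<^sup>2 = 4 * (y \<bullet> D)\<^sup>2 + 4 * ((y \<bullet> D) * (norm D)\<^sup>2) + ((norm D)\<^sup>2)\<^sup>2"
        by (simp add: w_def power2_eq_square algebra_simps)
      also have "\<dots> \<le> 4 * (s * ((norm D)\<^sup>2 - (e \<bullet> D)\<^sup>2)) + 4 * (q * K * K\<^sup>2) + (K\<^sup>2)\<^sup>2"
        using c D2 yD by (intro add_mono mult_left_mono mult_mono power_mono) (auto simp: assms less_imp_le q)
      also have "\<dots> \<le> 4 * (s * ((norm D)\<^sup>2 - (e \<bullet> D)\<^sup>2)) + 5 * \<epsilon> * K\<^sup>2 * s"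
      proof -
        have "q * K \<le> \<epsilon> * s" using Kq q by (metis mult.left_commute mult_left_mono less_imp_le power2_eq_square)
        then have a: "q * K * K\<^sup>2 \<le> \<epsilon> * s * K\<^sup>2" by (rule mult_right_mono) simp
        have "K \<le> q" using Kq ep1 q by (smt (verit) mult_right_le_one_le mult_left_le_one_le ep(1))
        then have "K * K \<le> q * K" using assms by (intro mult_right_mono) auto
        then have "K\<^sup>2 * K\<^sup>2 \<le> q * K * K\<^sup>2" by (intro mult_right_mono) (auto simp: power2_eq_square)
        then have "(K\<^sup>2)\<^sup>2 \<le> q * K * K\<^sup>2" by (simp only: power2_eq_square[of "K\<^sup>2"])
        with a show ?thesis by (simp add: algebra_simps)
      qed
      finally have "w\<^sup>2 / s \<le> 4 * ((norm D)\<^sup>2 - (e \<bullet> D)\<^sup>2) + 5 * \<epsilon> * K\<^sup>2"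
        using s1 by (simp add: field_simps)
      then have "(1 + 2 * \<theta>) / 4 * (w\<^sup>2 / s) \<le> (1 + 2 * \<theta>) / 4 * (4 * ((norm D)\<^sup>2 - (e \<bullet> D)\<^sup>2) + 5 * \<epsilon> * K\<^sup>2)"
        using th by (intro mult_left_mono) auto
      also have "\<dots> = (1 + 2 * \<theta>) * ((norm D)\<^sup>2 - (e \<bullet> D)\<^sup>2) + (1 + 2 * \<theta>) / 4 * (5 * \<epsilon> * K\<^sup>2)"
        by (simp add: field_simps)
      also have "\<dots> \<le> (norm D)\<^sup>2 - (e \<bullet> D)\<^sup>2 + 2 * \<theta> * K\<^sup>2 + 5 * \<epsilon> * K\<^sup>2"
      proof -
        have "2 * \<theta> * ((norm D)\<^sup>2 - (e \<bullet> D)\<^sup>2) \<le> 2 * \<theta> * K\<^sup>2"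
          using th D2 by (intro mult_left_mono) (auto intro: order.trans[OF _ D2])
        moreover have "(1 + 2 * \<theta>) / 4 * (5 * \<epsilon> * K\<^sup>2) \<le> 1 * (5 * \<epsilon> * K\<^sup>2)"
          using th ep by (intro mult_right_mono) auto
        ultimately show ?thesis by (simp add: field_simps)
      qed
      also have "\<dots> \<le> (norm D)\<^sup>2 - (e \<bullet> D)\<^sup>2 + \<eta>"
      proof -
        have "\<theta> * K\<^sup>2 \<le> \<eta> / 4" "\<epsilon> * K\<^sup>2 \<le> \<eta> / 10"
          using th(3) ep(3) assms by (simp_all add: field_simps)
        then show ?thesis by simp
      qed
      finally show ?thesis by (simp add: w_def)
    qed
    then have "p * s powr (p - 1) * (w - (1 + 2 * \<theta>) / 4 * (w\<^sup>2 / s))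
        \<ge> p * s powr (p - 1) * (2 * (y \<bullet> D) + (e \<bullet> D)\<^sup>2 - \<eta>)"
      using th by (intro mult_left_mono) (auto simp: p_def)
    ultimately show "(R\<^sup>2 + (norm (y + D))\<^sup>2) powr p - (R\<^sup>2 + (norm y)\<^sup>2) powr p
        \<ge> p * (R\<^sup>2 + (norm y)\<^sup>2) powr (p - 1) * (2 * (y \<bullet> D) + (e \<bullet> D)\<^sup>2 - \<eta>)"
      by (simp add: s_def)
  qed
qed

section \<open>Lattice sums and stopped telescoping sums\<close>

lemma
  fixes \<rho> :: real
  assumes "\<rho> \<ge> 0"
  shows finite_lattice_ball: "finite {x :: real ^ 'd. x \<in> int_lattice \<and> norm x \<le> \<rho>}"
    and card_lattice_ball: "real (card {x :: real ^ 'd. x \<in> int_lattice \<and> norm x \<le> \<rho>}) \<le> (2 * \<rho> + 1) ^ CARD('d)"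
proof -
  define I where "I = {- \<lfloor>\<rho>\<rfloor>..\<lfloor>\<rho>\<rfloor>}"
  define P where "P = PiE (UNIV :: 'd set) (\<lambda>_. I)"
  let ?B = "{x :: real ^ 'd. x \<in> int_lattice \<and> norm x \<le> \<rho>}"
  let ?g = "\<lambda>f. (\<chi> i. real_of_int (f i)) :: real ^ 'd"
  have sub: "?B \<subseteq> ?g ` P"
  proof
    fix x :: "real ^ 'd" assume x: "x \<in> ?B"
    have "\<lfloor>x $ i\<rfloor> \<in> I" for i
    proof -
      have "\<bar>x $ i\<bar> \<le> \<rho>" using component_le_norm_cart[of x i] x by simp
      then show ?thesis using le_floor_iff[of "- \<lfloor>\<rho>\<rfloor>" "x $ i"] le_floor_iff[of "\<lfloor>x $ i\<rfloor>" \<rho>]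
          le_floor_iff[of "- \<lfloor>x $ i\<rfloor>" \<rho>] of_int_floor_le[of "x $ i"] x
        unfolding I_def int_lattice_def by (auto elim!: Ints_cases dest!: spec[of _ i])
    qed
    then have "(\<lambda>i. \<lfloor>x $ i\<rfloor>) \<in> P" by (auto simp: P_def)
    moreover have "x = ?g (\<lambda>i. \<lfloor>x $ i\<rfloor>)"
      using x by (auto simp: int_lattice_def vec_eq_iff)
    ultimately show "x \<in> ?g ` P" using image_eqI[of x ?g "\<lambda>i. \<lfloor>x $ i\<rfloor>" P] by simp
  qed
  have fP: "finite P" unfolding P_def I_def by (intro finite_PiE) auto
  then show "finite ?B" using sub finite_subset by blast
  have "card ?B \<le> card (?g ` P)" using sub fP by (intro card_mono) auto
  also have "\<dots> \<le> card P" using fP by (rule card_image_le)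
  also have "\<dots> = card I ^ CARD('d)" by (simp add: P_def card_PiE)
  finally have "real (card ?B) \<le> real (card I) ^ CARD('d)" by (simp flip: of_nat_power)
  also have "real (card I) \<le> 2 * \<rho> + 1"
    using assms of_int_floor_le[of \<rho>] by (simp add: I_def)
  then have "real (card I) ^ CARD('d) \<le> (2 * \<rho> + 1) ^ CARD('d)" by (intro power_mono) auto
  finally show "real (card ?B) \<le> (2 * \<rho> + 1) ^ CARD('d)" .
qed

text \<open>Cut at radius \<rho> = N^(1/(2d)). Inside there are at most 3^d N^(1/2) lattice points,
  each with weight at most 1; outside there are at most N, each with weight at most \<rho>^(-t). The
  radius is not optimized, since any power saved over N is enough.\<close>

lemma sum_lattice_powr_le:
  fixes S :: "(real ^ 'd) set" and t R N :: real
  assumes S: "S \<subseteq> int_lattice" "finite S" "real (card S) \<le> N"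
    and t: "0 < t" "t \<le> 1" and R: "R \<ge> 1" and N: "N \<ge> 1"
  shows "(\<Sum>x\<in>S. (R\<^sup>2 + (norm x)\<^sup>2) powr (- (t / 2)))
    \<le> (3 ^ CARD('d) + 1) * N powr (1 - t / (2 * CARD('d)))"
proof -
  define d where "d = real CARD('d)"
  have d: "d \<ge> 1" by (simp add: d_def Suc_le_eq)
  define \<rho> where "\<rho> = N powr (1 / (2 * d))"
  have rho: "\<rho> \<ge> 1" unfolding \<rho>_def using N d by (intro ge_one_powr_ge_zero) auto
  let ?f = "\<lambda>x :: real ^ 'd. (R\<^sup>2 + (norm x)\<^sup>2) powr (- (t / 2))"
  let ?B = "{x :: real ^ 'd. x \<in> int_lattice \<and> norm x \<le> \<rho>}"
  have R2: "R\<^sup>2 \<ge> 1" using R by simp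
  have "(\<Sum>x\<in>S. ?f x) = (\<Sum>x\<in>S \<inter> ?B. ?f x) + (\<Sum>x\<in>S - ?B. ?f x)"
    using sum.Int_Diff[OF S(2)] by blast
  also have "(\<Sum>x\<in>S \<inter> ?B. ?f x) \<le> (\<Sum>x\<in>S \<inter> ?B. 1)"
  proof (rule sum_mono)
    fix x :: "real ^ 'd"
    have "1 \<le> R\<^sup>2 + (norm x)\<^sup>2" using R2 by (simp add: add_increasing2)
    then show "?f x \<le> 1"
      using powr_mono2'[of "- (t / 2)" 1 "R\<^sup>2 + (norm x)\<^sup>2"] t by simp
  qed
  also have "\<dots> \<le> real (card ?B)"
    using finite_lattice_ball[where 'd = 'd, of \<rho>] rho by (simp add: card_mono)
  also have "\<dots> \<le> (2 * \<rho> + 1) ^ CARD('d)" using rho by (intro card_lattice_ball) auto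
  also have "\<dots> \<le> (3 * \<rho>) ^ CARD('d)" using rho by (intro power_mono) auto
  also have "\<dots> = 3 ^ CARD('d) * N powr (1/2)"
  proof -
    have "\<rho> ^ CARD('d) = \<rho> powr d" using rho by (simp add: d_def powr_realpow)
    also have "\<dots> = N powr (1/2)" using d by (simp add: \<rho>_def powr_powr)
    finally show ?thesis by (simp add: power_mult_distrib)
  qed
  also have "\<dots> \<le> 3 ^ CARD('d) * N powr (1 - t / (2 * d))"
  proof -
    have "t / (2 * d) \<le> 1 / 2" using t d by (simp add: field_simps)
    then show ?thesis using N by (intro mult_left_mono powr_mono) auto
  qed
  also have "(\<Sum>x\<in>S - ?B. ?f x) \<le> (\<Sum>x\<in>S - ?B. \<rho> powr (- t))"
  proof (rule sum_mono)
    fix x assume "x \<in> S - ?B"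
    then have x: "norm x > \<rho>" using S(1) by auto
    then have "\<rho>\<^sup>2 \<le> R\<^sup>2 + (norm x)\<^sup>2" using rho by (simp add: add_increasing power_mono)
    then have "?f x \<le> (\<rho>\<^sup>2) powr (- (t / 2))"
      using t rho by (intro powr_mono2') auto
    also have "\<dots> = \<rho> powr (- t)"
      using rho by (simp add: powr_powr flip: powr_numeral)
    finally show "?f x \<le> \<rho> powr (- t)" .
  qed
  also have "\<dots> = real (card (S - ?B)) * \<rho> powr (- t)" by simp
  also have "\<dots> \<le> N * \<rho> powr (- t)"
  proof (rule mult_right_mono)
    have "card (S - ?B) \<le> card S" using S by (intro card_mono) auto
    then show "real (card (S - ?B)) \<le> N" using S by linarith
  qed simp
  also have "\<dots> = N powr (1 - t / (2 * d))"
    using N by (simp add: \<rho>_def powr_powr powr_diff powr_minus field_simps)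
  finally show ?thesis by (simp add: d_def algebra_simps)
qed

text \<open>\<open>B\<close> holds up to some time and never again, so the sum telescopes to the
  value of \<phi> at the stopping time minus \<open>\<phi> i\<close>. Of the stopped value only the
  sign is used.\<close>

lemma stopped_sum_ge:
  fixes \<phi> :: "nat \<Rightarrow> real" and B :: "nat \<Rightarrow> bool"
  assumes dec: "\<And>k. B (Suc k) \<Longrightarrow> B k" and nn: "\<And>k. \<phi> k \<ge> 0" and "i \<le> n"
  shows "(\<Sum>k=i..<n. of_bool (B k) * (\<phi> (Suc k) - \<phi> k)) \<ge> - \<phi> i"
proof -
  define S where "S n = (\<Sum>k=i..<n. of_bool (B k) * (\<phi> (Suc k) - \<phi> k))" for n
  have "S n \<ge> - \<phi> i \<and> (n > i \<longrightarrow> B (n - 1) \<longrightarrow> S n = \<phi> n - \<phi> i)"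
    using \<open>i \<le> n\<close>
  proof (induction n rule: dec_induct)
    case base
    then show ?case using nn[of i] by (simp add: S_def)
  next
    case (step n)
    have S: "S (Suc n) = S n + of_bool (B n) * (\<phi> (Suc n) - \<phi> n)"
      using step.hyps by (simp add: S_def)
    show ?case
    proof (cases "B n")
      case True
      have "S n = \<phi> n - \<phi> i"
      proof (cases "n = i")
        case False
        then show ?thesis using step True dec[of "n - 1"] by auto
      qed (simp add: S_def)
      then show ?thesis using S True nn[of "Suc n"] by simp
    qed (use S step in auto)
  qed
  then show ?thesis by (simp add: S_def)
qed

section \<open>Conditional moments of the increments\<close>

context GERW
begin

abbreviation incr :: "nat \<Rightarrow> 'a \<Rightarrow> real ^ 'd" where
  "incr n \<omega> \<equiv> X (Suc n) \<omega> - X n \<omega>"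

definition cond_drift :: "nat \<Rightarrow> 'a \<Rightarrow> real ^ 'd" where
  "cond_drift n = vec_cond_exp M (F n) (incr n)"

definition driftless :: "nat \<Rightarrow> 'a set" where
  "driftless n = {\<omega> \<in> space M. cond_drift n \<omega> = 0}"

lemma subalgebra_F: "subalgebra M (F n)"
  using sets_F_subset space_F by (simp add: subalgebra_def)

sublocale FF: finite_measure_subalgebra M "F n" for n
  by unfold_locales (rule subalgebra_F)

lemma F_imp_M: "D \<in> sets (F n) \<Longrightarrow> D \<in> sets M"
  using sets_F_subset by blast

lemma F_mono: "D \<in> sets (F k) \<Longrightarrow> k \<le> n \<Longrightarrow> D \<in> sets (F n)"
  using sets_F_mono by blast

lemma measurable_F_mono: "f \<in> borel_measurable (F k) \<Longrightarrow> k \<le> n \<Longrightarrow> f \<in> borel_measurable (F n)"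
  using sets_F_mono space_F by (metis (no_types, lifting) measurable_from_subalg subalgebra_def)

lemma measurable_F_imp_M: "f \<in> borel_measurable (F n) \<Longrightarrow> f \<in> borel_measurable M"
  using measurable_from_subalg subalgebra_F by blast

lemma X_F [measurable]: "k \<le> n \<Longrightarrow> X k \<in> borel_measurable (F n)"
  using adapted measurable_F_mono by blast

lemma X_M [measurable]: "X n \<in> borel_measurable M"
  using adapted measurable_F_imp_M by blast

lemma norm_incr_le:
  assumes "\<omega> \<in> space M"
  shows "norm (incr n \<omega>) \<le> K"
proof -
  have "ereal (norm (incr n \<omega>)) \<le> (SUP n. ereal (norm (incr n \<omega>)))" by (rule SUP_upper) simp
  also have "\<dots> < ereal K" using bounded_increments[OF assms] .
  finally show ?thesis by simp
qed

lemma norm_X_le: "\<omega> \<in> space M \<Longrightarrow> norm (X n \<omega>) \<le> K * n"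
proof (induction n)
  case (Suc n)
  then show ?case
    using norm_incr_le[of \<omega> n] norm_triangle_ineq[of "X n \<omega>" "incr n \<omega>"] by (simp add: algebra_simps)
qed (simp add: start)

lemma integrable_indicator_mult:
  fixes f :: "'a \<Rightarrow> real"
  assumes "D \<in> sets M" "integrable M f"
  shows "integrable M (\<lambda>\<omega>. indicator D \<omega> * f \<omega>)"
  by (subst mult.commute) (rule integrable_real_mult_indicator[OF assms])

lemma integrable_bounded_indicator:
  fixes f :: "'a \<Rightarrow> real"
  assumes "f \<in> borel_measurable M" "\<And>\<omega>. \<omega> \<in> space M \<Longrightarrow> \<bar>f \<omega>\<bar> \<le> C" and D: "D \<in> sets M"
  shows "integrable M (\<lambda>\<omega>. indicator D \<omega> * f \<omega>)"
proof (rule integrable_const_bound[where B = "\<bar>C\<bar>"])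
  show "AE \<omega> in M. norm (indicator D \<omega> * f \<omega>) \<le> \<bar>C\<bar>"
    using assms(2) by (intro AE_I2) (force simp: indicator_def)
qed (use assms in measurable)

lemma
  shows incr_comp_M: "(\<lambda>\<omega>. incr n \<omega> $ i) \<in> borel_measurable M"
    and incr_comp_bound: "\<omega> \<in> space M \<Longrightarrow> \<bar>incr n \<omega> $ i\<bar> \<le> K"
    and integrable_incr_comp: "integrable M (\<lambda>\<omega>. incr n \<omega> $ i)"
proof -
  have a: "(\<lambda>\<omega>. incr n \<omega> $ i) = (\<lambda>\<omega>. incr n \<omega> \<bullet> axis i 1)" by (simp add: inner_axis)
  show 1: "(\<lambda>\<omega>. incr n \<omega> $ i) \<in> borel_measurable M" unfolding a by measurable
  show 2: "\<bar>incr n \<omega> $ i\<bar> \<le> K" if "\<omega> \<in> space M" for \<omega>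
    using norm_incr_le[OF that, of n] component_le_norm_cart[of "incr n \<omega>" i] by linarith
  show "integrable M (\<lambda>\<omega>. incr n \<omega> $ i)"
    using 1 2 by (intro integrable_const_bound[where B = K]) auto
qed

lemma cond_drift_comp: "cond_drift n \<omega> $ i = real_cond_exp M (F n) (\<lambda>\<omega>. incr n \<omega> $ i) \<omega>"
  by (simp add: cond_drift_def vec_cond_exp_def)

lemma cond_drift_inner_F: "(\<lambda>\<omega>. cond_drift n \<omega> \<bullet> v) \<in> borel_measurable (F n)"
  unfolding inner_vec_def cond_drift_comp by simp

lemma driftless_F: "driftless n \<in> sets (F n)"
proof -
  have "driftless n = {\<omega> \<in> space (F n). \<forall>i. real_cond_exp M (F n) (\<lambda>\<omega>. incr n \<omega> $ i) \<omega> = 0}"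
    by (auto simp: driftless_def vec_eq_iff cond_drift_comp space_F)
  also have "\<dots> \<in> sets (F n)" by measurable
  finally show ?thesis .
qed

lemma integrable_incr_inner: "integrable M (\<lambda>\<omega>. incr n \<omega> \<bullet> v)"
  unfolding inner_vec_def inner_real_def
  by (intro Bochner_Integration.integrable_sum integrable_mult_left integrable_incr_comp)

lemma integrable_mult_incr_comp:
  assumes "integrable M f"
  shows "integrable M (\<lambda>\<omega>. f \<omega> * incr n \<omega> $ i)"
proof (rule Bochner_Integration.integrable_bound)
  show "integrable M (\<lambda>\<omega>. f \<omega> * K)" using assms by simp
  show "(\<lambda>\<omega>. f \<omega> * incr n \<omega> $ i) \<in> borel_measurable M"
    using assms incr_comp_M by (intro borel_measurable_times) auto
  show "AE \<omega> in M. norm (f \<omega> * incr n \<omega> $ i) \<le> norm (f \<omega> * K)"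
    using incr_comp_bound K_pos by (intro AE_I2) (auto simp: abs_mult intro!: mult_left_mono)
qed

text \<open>The conditional expectation is componentwise, so \<open>f\<close> is pulled out in each
  coordinate and the coordinates are recombined. An indicator for \<open>f\<close> kills linear
  terms on driftless events; a stopped martingale for \<open>f\<close> gives orthogonality of
  increments.\<close>

lemma
  assumes f: "f \<in> borel_measurable (F n)" "integrable M f"
  shows integral_incr_inner:
      "(\<integral>\<omega>. f \<omega> * (incr n \<omega> \<bullet> v) \<partial>M) = (\<integral>\<omega>. f \<omega> * (cond_drift n \<omega> \<bullet> v) \<partial>M)"
    and integrable_mult_incr: "integrable M (\<lambda>\<omega>. f \<omega> * (incr n \<omega> \<bullet> v))"
    and integrable_mult_cond_drift: "integrable M (\<lambda>\<omega>. f \<omega> * (cond_drift n \<omega> \<bullet> v))"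
proof -
  note i1 = integrable_mult_incr_comp[OF f(2), of n]
  note ce = FF.real_cond_exp_intg[OF i1 f(1) incr_comp_M, folded cond_drift_comp]
  have e1: "f \<omega> * (incr n \<omega> \<bullet> v) = (\<Sum>i\<in>UNIV. f \<omega> * incr n \<omega> $ i * v $ i)" for \<omega>
    by (simp add: inner_vec_def sum_distrib_left mult.assoc del: vector_minus_component)
  have e2: "f \<omega> * (cond_drift n \<omega> \<bullet> v) = (\<Sum>i\<in>UNIV. f \<omega> * cond_drift n \<omega> $ i * v $ i)" for \<omega>
    by (simp add: inner_vec_def sum_distrib_left mult.assoc)
  show "integrable M (\<lambda>\<omega>. f \<omega> * (incr n \<omega> \<bullet> v))"
    unfolding e1 by (intro Bochner_Integration.integrable_sum integrable_mult_left i1)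
  show "integrable M (\<lambda>\<omega>. f \<omega> * (cond_drift n \<omega> \<bullet> v))"
    unfolding e2 by (intro Bochner_Integration.integrable_sum integrable_mult_left ce(1))
  show "(\<integral>\<omega>. f \<omega> * (incr n \<omega> \<bullet> v) \<partial>M) = (\<integral>\<omega>. f \<omega> * (cond_drift n \<omega> \<bullet> v) \<partial>M)"
    unfolding e1 e2
    by (subst (1 2) Bochner_Integration.integral_sum)
      (simp_all only: integrable_mult_left i1 ce integral_mult_left_zero)
qed

lemma integral_incr_driftless:
  assumes "D \<in> sets (F n)" "D \<subseteq> driftless n"
  shows "(\<integral>\<omega>. indicator D \<omega> * (incr n \<omega> \<bullet> v) \<partial>M) = 0"
proof -
  have "(\<integral>\<omega>. indicat_real D \<omega> * (cond_drift n \<omega> \<bullet> v) \<partial>M) = (\<integral>\<omega>. 0 \<partial>M)"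
    using assms(2) by (intro Bochner_Integration.integral_cong) (auto simp: driftless_def indicator_def)
  moreover have "integrable M (indicat_real D)"
    using F_imp_M[OF assms(1)] by (simp add: emeasure_eq_measure)
  moreover have "indicat_real D \<in> borel_measurable (F n)" using assms(1) by simp
  ultimately show ?thesis by (simp only: integral_incr_inner Bochner_Integration.integral_zero)
qed

text \<open>Integration over an event of \<open>F n\<close> turns the almost sure conditional bound
  into an inequality between probabilities. Both forms of ellipticity are used through it.\<close>

lemma prob_incr_gt:
  assumes D: "D \<in> sets (F n)"
    and AE: "AE \<omega> in M. \<omega> \<in> D \<longrightarrow> cond_probability M (F n) (\<lambda>\<omega>. incr n \<omega> \<bullet> v > r) \<omega> \<ge> h"
  shows "prob {\<omega> \<in> D. incr n \<omega> \<bullet> v > r} \<ge> h * prob D"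
proof -
  let ?G = "{\<omega> \<in> space M. incr n \<omega> \<bullet> v > r}"
  have G: "?G \<in> sets M" by measurable
  have DM: "D \<in> sets M" using D F_imp_M by blast
  have int: "integrable M (\<lambda>\<omega>. indicator D \<omega> * indicat_real ?G \<omega>)"
    by (rule integrable_bounded_indicator[where C = 1, OF _ _ DM]) (use G in \<open>auto simp: indicator_def\<close>)
  have mD: "indicat_real D \<in> borel_measurable (F n)" using D by simp
  have mG: "indicat_real ?G \<in> borel_measurable M" using G by simp
  note ce = FF.real_cond_exp_intg[OF int mD mG]
  have "h * prob D = (\<integral>\<omega>. h * indicator D \<omega> \<partial>M)" using DM by simp
  also have "\<dots> \<le> (\<integral>\<omega>. indicator D \<omega> * cond_probability M (F n) (\<lambda>\<omega>. incr n \<omega> \<bullet> v > r) \<omega> \<partial>M)"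
  proof (rule integral_mono_AE)
    show "integrable M (\<lambda>\<omega>. h * indicat_real D \<omega>)" using DM by (simp add: emeasure_eq_measure)
    show "integrable M (\<lambda>\<omega>. indicat_real D \<omega> * cond_probability M (F n) (\<lambda>\<omega>. incr n \<omega> \<bullet> v > r) \<omega>)"
      using ce(1) by (simp add: cond_probability_def)
    show "AE \<omega> in M. h * indicat_real D \<omega> \<le> indicat_real D \<omega> * cond_probability M (F n) (\<lambda>\<omega>. incr n \<omega> \<bullet> v > r) \<omega>"
      using AE by eventually_elim (auto simp: indicator_def)
  qed
  also have "\<dots> = (\<integral>\<omega>. indicator D \<omega> * indicat_real ?G \<omega> \<partial>M)"
    using ce(2) by (simp add: cond_probability_def)
  also have "\<dots> = (\<integral>\<omega>. indicat_real (D \<inter> ?G) \<omega> \<partial>M)"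
    by (simp add: indicator_inter_arith)
  also have "\<dots> = prob (D \<inter> ?G)" using DM G by simp
  also have "D \<inter> ?G = {\<omega> \<in> D. incr n \<omega> \<bullet> v > r}" using sets.sets_into_space[OF DM] by auto
  finally show ?thesis .
qed

text \<open>Chebyshev's inequality read backwards: increments exceeding r along e already contribute
  r^2 with conditional probability at least h. The direction e is deterministic, as the null set in
  the ellipticity condition may vary with it.\<close>

lemma integral_incr_square:
  assumes D: "D \<in> sets (F n)" "D \<subseteq> driftless n" and e: "norm e = 1"
  shows "(\<integral>\<omega>. indicator D \<omega> * (e \<bullet> incr n \<omega>)\<^sup>2 \<partial>M) \<ge> h * r\<^sup>2 * prob D"
proof -
  let ?G = "{\<omega> \<in> D. incr n \<omega> \<bullet> e > r}"
  have DM: "D \<in> sets M" using D F_imp_M by blast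
  have G: "?G \<in> sets M" using DM by measurable
  have "h * prob D \<le> prob ?G"
  proof (rule prob_incr_gt[OF D(1)])
    show "AE \<omega> in M. \<omega> \<in> D \<longrightarrow> h \<le> cond_probability M (F n) (\<lambda>\<omega>. r < incr n \<omega> \<bullet> e) \<omega>"
      using ellipticity_all[OF e, of n]
      by eventually_elim (use D(2) in \<open>auto simp: driftless_def cond_drift_def\<close>)
  qed
  then have "r\<^sup>2 * (h * prob D) \<le> r\<^sup>2 * prob ?G" by (rule mult_left_mono) simp
  then have "h * r\<^sup>2 * prob D \<le> r\<^sup>2 * prob ?G" by (simp only: mult.assoc mult.left_commute)
  also have "\<dots> = (\<integral>\<omega>. r\<^sup>2 * indicator ?G \<omega> \<partial>M)" using G by simp
  also have "\<dots> \<le> (\<integral>\<omega>. indicator D \<omega> * (e \<bullet> incr n \<omega>)\<^sup>2 \<partial>M)"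
  proof (rule integral_mono)
    show "integrable M (\<lambda>\<omega>. indicator D \<omega> * (e \<bullet> incr n \<omega>)\<^sup>2)"
    proof (rule integrable_bounded_indicator[where C = "K\<^sup>2", OF _ _ DM])
      fix \<omega> assume "\<omega> \<in> space M"
      then have "\<bar>e \<bullet> incr n \<omega>\<bar> \<le> K"
        using Cauchy_Schwarz_ineq2[of e "incr n \<omega>"] norm_incr_le[of \<omega> n] e by simp
      then show "\<bar>(e \<bullet> incr n \<omega>)\<^sup>2\<bar> \<le> K\<^sup>2"
        using K_pos by (simp add: abs_le_square_iff[symmetric])
    qed measurable
    show "integrable M (\<lambda>\<omega>. r\<^sup>2 * indicat_real ?G \<omega>)" using G by (simp add: emeasure_eq_measure)
    fix \<omega>
    show "r\<^sup>2 * indicat_real ?G \<omega> \<le> indicator D \<omega> * (e \<bullet> incr n \<omega>)\<^sup>2"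
      using r_pos by (auto simp: indicator_def inner_commute intro!: power_mono)
  qed
  finally show ?thesis .
qed

end

section \<open>The number of new sites\<close>

text \<open>
  The square root term grows by at most \<open>K\<^sup>2 / (2 * sqrt m)\<close> per zero-drift step and dominates the
  potential far away. So the sum is bounded below, and telescoping it up to a stopping time requires
  no estimate of the position of the walk at that time.
\<close>

definition test_fun :: "real \<Rightarrow> real \<Rightarrow> real \<Rightarrow> real \<Rightarrow> 'v :: real_inner \<Rightarrow> real" where
  "test_fun c m p R y = c * sqrt (m + (norm y)\<^sup>2) - (R\<^sup>2 + (norm y)\<^sup>2) powr p"

text \<open>The square root lies below its tangent: a - b \<le> (a^2 - b^2) / (2b) because (a - b)^2
  \<ge> 0.\<close>

lemma sqrt_potential_step:
  fixes y D :: "'v :: real_inner"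
  assumes "m \<ge> 1"
  shows "sqrt (m + (norm (y + D))\<^sup>2) - sqrt (m + (norm y)\<^sup>2)
    \<le> (2 * (y \<bullet> D) + (norm D)\<^sup>2) / (2 * sqrt (m + (norm y)\<^sup>2))"
proof -
  let ?a = "sqrt (m + (norm (y + D))\<^sup>2)" and ?b = "sqrt (m + (norm y)\<^sup>2)"
  have p: "m + (norm y)\<^sup>2 > 0" "m + (norm (y + D))\<^sup>2 > 0"
    using assms by (smt (verit) zero_le_power2)+
  have "2 * (y \<bullet> D) + (norm D)\<^sup>2 = ?a\<^sup>2 - ?b\<^sup>2"
    using p by (simp add: power2_norm_eq_inner inner_add_left inner_add_right inner_commute)
  moreover have "2 * ?b * (?a - ?b) \<le> ?a\<^sup>2 - ?b\<^sup>2"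
    using zero_le_power2[of "?a - ?b"] by (simp add: power2_eq_square algebra_simps)
  ultimately show ?thesis using p by (simp add: field_simps)
qed

text \<open>The deterministic inequality is an assumption on the parameters p and R, so that both
  can be fixed from K, h, r before any process is given. With \<eta> equal to half of the guaranteed
  second moment h r^2, half of the ellipticity gain survives the error.\<close>

locale GERW_potential = GERW M F l lam A K h r X
  for M :: "'a measure" and F and l :: "real ^ 'd" and lam A K h r X +
  fixes p R \<eta> :: real
  defines "\<eta> \<equiv> h * r\<^sup>2 / 2"
  assumes p: "0 < p" "p < 1/2" and R: "R \<ge> 1"
    and potential_step: "\<And>y D e :: real ^ 'd. norm D \<le> K \<Longrightarrow> norm e = 1 \<Longrightarrow> e \<bullet> y = 0 \<Longrightarrow>
      (R\<^sup>2 + (norm (y + D))\<^sup>2) powr p - (R\<^sup>2 + (norm y)\<^sup>2) powr p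
        \<ge> p * (R\<^sup>2 + (norm y)\<^sup>2) powr (p - 1) * (2 * (y \<bullet> D) + (e \<bullet> D)\<^sup>2 - \<eta>)"
begin

lemma eta_pos: "\<eta> > 0"
  using h_pos r_pos by (simp add: \<eta>_def)

lemma base_ge_1: "R\<^sup>2 + (norm (y :: real ^ 'd))\<^sup>2 \<ge> 1"
  using R by (simp add: add_increasing2)

lemma base_pos: "R\<^sup>2 + (norm (y :: real ^ 'd))\<^sup>2 > 0"
  using base_ge_1[of y] by linarith

lemma orthogonal_unit:
  obtains e :: "real ^ 'd" where "norm e = 1" "e \<bullet> y = 0"
proof -
  have "2 \<le> DIM(real ^ 'd)" using dimension by simp
  then obtain z :: "real ^ 'd" where z: "z \<noteq> 0" "orthogonal y z"
    using orthogonal_to_vector_exists by blast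
  show ?thesis
    by (rule that[of "z /\<^sub>R norm z"]) (use z in \<open>auto simp: orthogonal_def inner_commute\<close>)
qed

text \<open>The guaranteed expected growth of the power potential in one driftless step that starts
  at displacement 0, that is, at a return to the reference site.\<close>

definition return_gain :: real where "return_gain = p * \<eta> * (R\<^sup>2) powr (p - 1)"

lemma return_gain_pos: "return_gain > 0"
  using p eta_pos R by (simp add: return_gain_def)

lemma test_fun_step_le:
  fixes y D e :: "real ^ 'd"
  assumes "c \<ge> 0" "m \<ge> 1" "norm D \<le> K" "norm e = 1" "e \<bullet> y = 0"
  shows "test_fun c m p R (y + D) - test_fun c m p R y
    \<le> c * ((2 * (y \<bullet> D) + K\<^sup>2) / (2 * sqrt (m + (norm y)\<^sup>2)))
      - p * (R\<^sup>2 + (norm y)\<^sup>2) powr (p - 1) * (2 * (y \<bullet> D) + (e \<bullet> D)\<^sup>2 - \<eta>)"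
proof -
  have "(norm D)\<^sup>2 \<le> K\<^sup>2" using assms by (simp add: power_mono)
  then have "(2 * (y \<bullet> D) + (norm D)\<^sup>2) / (2 * sqrt (m + (norm y)\<^sup>2))
      \<le> (2 * (y \<bullet> D) + K\<^sup>2) / (2 * sqrt (m + (norm y)\<^sup>2))"
    using assms by (intro divide_right_mono) (auto simp: add_nonneg_nonneg)
  then have "c * (sqrt (m + (norm (y + D))\<^sup>2) - sqrt (m + (norm y)\<^sup>2))
      \<le> c * ((2 * (y \<bullet> D) + K\<^sup>2) / (2 * sqrt (m + (norm y)\<^sup>2)))"
    using sqrt_potential_step[OF assms(2), of y D] assms(1) by (intro mult_left_mono) auto
  then show ?thesis using potential_step[OF assms(3-5)] by (simp add: test_fun_def algebra_simps)
qed

text \<open>Nothing is known about y.D when there is drift, so the gradient of the potential is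
  estimated at its worst: s^(p - 1) times a multiple of sqrt s. As p < 1/2, the resulting power of s
  decays in y, which makes distinct first visits cheap on average.\<close>

lemma test_fun_step_drift:
  fixes y D :: "real ^ 'd"
  assumes "c \<ge> 0" "m \<ge> 1" "norm D \<le> K"
  shows "test_fun c m p R (y + D) - test_fun c m p R y
    \<le> c * (K + K\<^sup>2) + (2 * K + \<eta>) * (R\<^sup>2 + (norm y)\<^sup>2) powr (p - 1/2)"
proof -
  obtain e :: "real ^ 'd" where e: "norm e = 1" "e \<bullet> y = 0" using orthogonal_unit by blast
  define s where "s = R\<^sup>2 + (norm y)\<^sup>2"
  define q where "q = sqrt (m + (norm y)\<^sup>2)"
  have s: "s \<ge> 1" using base_ge_1 by (simp add: s_def)
  have q: "q \<ge> 1" "norm y \<le> q" using assms(2) unfolding q_def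
    by (auto intro!: real_le_rsqrt simp: add_increasing2)
  have ys: "norm y \<le> sqrt s" unfolding s_def by (rule real_le_rsqrt) simp
  have yD: "\<bar>y \<bullet> D\<bar> \<le> norm y * K"
    using Cauchy_Schwarz_ineq2[of y D] assms(3) by (meson mult_left_mono norm_ge_zero order.trans)
  have "(2 * (y \<bullet> D) + K\<^sup>2) / (2 * q) \<le> K + K\<^sup>2"
  proof -
    have "y \<bullet> D \<le> q * K" using yD mult_right_mono[OF q(2), of K] K_pos by linarith
    moreover have "K\<^sup>2 \<le> K\<^sup>2 * (2 * q)" using mult_left_mono[of 1 "2 * q" "K\<^sup>2"] q by simp
    ultimately show ?thesis using q by (simp add: field_simps)
  qed
  then have 1: "c * ((2 * (y \<bullet> D) + K\<^sup>2) / (2 * q)) \<le> c * (K + K\<^sup>2)"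
    using assms(1) by (rule mult_left_mono)
  have "2 * (y \<bullet> D) + (e \<bullet> D)\<^sup>2 - \<eta> \<ge> - (2 * K + \<eta>) * sqrt s"
  proof -
    have "\<bar>y \<bullet> D\<bar> \<le> K * sqrt s"
      using order.trans[OF yD mult_right_mono[OF ys less_imp_le[OF K_pos]]] by (simp add: mult.commute)
    moreover have "\<eta> \<le> \<eta> * sqrt s" using mult_left_mono[of 1 "sqrt s" \<eta>] s eta_pos by simp
    moreover have "- (2 * K + \<eta>) * sqrt s = - (2 * (K * sqrt s)) - \<eta> * sqrt s" by (simp add: algebra_simps)
    ultimately show ?thesis using zero_le_power2[of "e \<bullet> D"] by linarith
  qed
  then have "p * s powr (p - 1) * (- (2 * K + \<eta>) * sqrt s) \<le> p * s powr (p - 1) * (2 * (y \<bullet> D) + (e \<bullet> D)\<^sup>2 - \<eta>)"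
    using p by (intro mult_left_mono) auto
  moreover have "s powr (p - 1) * sqrt s = s powr (p - 1/2)"
  proof -
    have "sqrt s = s powr (1/2)" using s by (simp add: powr_half_sqrt)
    then show ?thesis by (simp flip: powr_add)
  qed
  then have "p * s powr (p - 1) * (- (2 * K + \<eta>) * sqrt s) = - (p * ((2 * K + \<eta>) * s powr (p - 1/2)))"
    by (metis (no_types, opaque_lifting) mult.assoc mult.commute mult_minus_right)
  moreover have "p * ((2 * K + \<eta>) * s powr (p - 1/2)) \<le> 1 * ((2 * K + \<eta>) * s powr (p - 1/2))"
    using p K_pos eta_pos by (intro mult_right_mono) auto
  ultimately show ?thesis
    using test_fun_step_le[OF assms e] 1 unfolding s_def[symmetric] q_def[symmetric] by linarith
qed

section \<open>Expected one-step change of the test function\<close>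

lemma abs_test_fun_le:
  fixes z :: "real ^ 'd"
  assumes "c \<ge> 0" "m \<ge> 1" "norm z \<le> L"
  shows "\<bar>test_fun c m p R z\<bar> \<le> c * sqrt (m + L\<^sup>2) + (R\<^sup>2 + L\<^sup>2) powr p"
proof -
  have z: "(norm z)\<^sup>2 \<le> L\<^sup>2" using assms by (simp add: power_mono)
  then have "c * sqrt (m + (norm z)\<^sup>2) \<le> c * sqrt (m + L\<^sup>2)" using assms(1) by (intro mult_left_mono) auto
  moreover have "(R\<^sup>2 + (norm z)\<^sup>2) powr p \<le> (R\<^sup>2 + L\<^sup>2) powr p"
    using z p base_pos[of z] by (intro powr_mono2) auto
  moreover have "c * sqrt (m + (norm z)\<^sup>2) \<ge> 0" using assms(1,2) by simp
  ultimately show ?thesis unfolding test_fun_def by (smt (verit) powr_ge_zero)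
qed

lemma integrable_test_fun:
  fixes V :: "'a \<Rightarrow> real ^ 'd"
  assumes "c \<ge> 0" "m \<ge> 1" "V \<in> borel_measurable M" "\<And>\<omega>. \<omega> \<in> space M \<Longrightarrow> norm (V \<omega>) \<le> L"
  shows "integrable M (\<lambda>\<omega>. test_fun c m p R (V \<omega>))"
proof (rule integrable_const_bound)
  show "AE \<omega> in M. norm (test_fun c m p R (V \<omega>)) \<le> c * sqrt (m + L\<^sup>2) + (R\<^sup>2 + L\<^sup>2) powr p"
    using abs_test_fun_le[OF assms(1,2,4)] by (intro AE_I2) simp
  show "(\<lambda>\<omega>. test_fun c m p R (V \<omega>)) \<in> borel_measurable M"
    using assms(3) unfolding test_fun_def by measurable
qed

text \<open>For a fixed y the terms linear in the increment have constant coefficients and integrate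
  to 0 over a driftless event. With \<open>a\<close> = p s^(p - 1), the quadratic term yields at
  least a h r^2 = 2 a \<eta>, against an error of a \<eta>.\<close>

lemma integral_test_fun_step_fixed:
  fixes y :: "real ^ 'd"
  assumes "c \<ge> 0" "m \<ge> 1" and D: "D \<in> sets (F n)" "D \<subseteq> driftless n"
  shows "(\<integral>\<omega>. indicator D \<omega> * (test_fun c m p R (y + incr n \<omega>) - test_fun c m p R y) \<partial>M)
    \<le> (c * K\<^sup>2 / (2 * sqrt m) - p * \<eta> * (R\<^sup>2 + (norm y)\<^sup>2) powr (p - 1)) * prob D"
proof -
  obtain e :: "real ^ 'd" where e: "norm e = 1" "e \<bullet> y = 0" using orthogonal_unit by blast
  define s where "s = R\<^sup>2 + (norm y)\<^sup>2"
  define q where "q = sqrt (m + (norm y)\<^sup>2)"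
  define a where "a = p * s powr (p - 1)"
  have DM: "D \<in> sets M" using D F_imp_M by blast
  have q: "q \<ge> sqrt m" "sqrt m > 0" using assms(2) by (auto simp: q_def)
  have a: "a \<ge> 0" using p by (simp add: a_def)
  have i0: "integrable M (\<lambda>\<omega>. indicat_real D \<omega>)" using DM by (simp add: emeasure_eq_measure)
  have i1: "integrable M (\<lambda>\<omega>. indicator D \<omega> * (incr n \<omega> \<bullet> y))"
    by (rule integrable_indicator_mult[OF DM integrable_incr_inner])
  have i2: "integrable M (\<lambda>\<omega>. indicator D \<omega> * (e \<bullet> incr n \<omega>)\<^sup>2)"
  proof (rule integrable_bounded_indicator[where C = "K\<^sup>2", OF _ _ DM])
    fix \<omega> assume "\<omega> \<in> space M"
    then have "\<bar>e \<bullet> incr n \<omega>\<bar> \<le> K"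
      using Cauchy_Schwarz_ineq2[of e "incr n \<omega>"] norm_incr_le[of \<omega> n] e by simp
    then show "\<bar>(e \<bullet> incr n \<omega>)\<^sup>2\<bar> \<le> K\<^sup>2"
      using K_pos by (simp add: abs_le_square_iff[symmetric])
  qed measurable
  have step: "test_fun c m p R (y + incr n \<omega>) - test_fun c m p R y
      \<le> (c / q - 2 * a) * (incr n \<omega> \<bullet> y) + (c * K\<^sup>2 / (2 * q) + a * \<eta>) - a * (e \<bullet> incr n \<omega>)\<^sup>2"
    if "\<omega> \<in> space M" for \<omega>
  proof -
    have "c * ((2 * (y \<bullet> incr n \<omega>) + K\<^sup>2) / (2 * q)) = c / q * (y \<bullet> incr n \<omega>) + c * K\<^sup>2 / (2 * q)"
      using q by (simp only: add_divide_distrib distrib_left) simp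
    then show ?thesis
      using test_fun_step_le[OF assms(1,2) norm_incr_le[OF that] e, of n]
      unfolding s_def[symmetric] q_def[symmetric] a_def[symmetric] right_diff_distrib left_diff_distrib
        distrib_left distrib_right inner_commute[of "incr n \<omega>"]
      by (simp only: mult.assoc mult.left_commute[of 2])
  qed
  have "(\<integral>\<omega>. indicator D \<omega> * (test_fun c m p R (y + incr n \<omega>) - test_fun c m p R y) \<partial>M)
    \<le> (\<integral>\<omega>. (c / q - 2 * a) * (indicator D \<omega> * (incr n \<omega> \<bullet> y))
        + (c * K\<^sup>2 / (2 * q) + a * \<eta>) * indicator D \<omega>
        - a * (indicator D \<omega> * (e \<bullet> incr n \<omega>)\<^sup>2) \<partial>M)"
  proof (rule integral_mono)
    show "integrable M (\<lambda>\<omega>. indicator D \<omega> * (test_fun c m p R (y + incr n \<omega>) - test_fun c m p R y))"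
    proof (intro integrable_indicator_mult[OF DM] Bochner_Integration.integrable_diff integrable_test_fun[OF assms(1,2)])
      show "norm (y + incr n \<omega>) \<le> norm y + K" if "\<omega> \<in> space M" for \<omega>
        using norm_incr_le[OF that, of n] norm_triangle_ineq[of y "incr n \<omega>"] by linarith
    qed auto
    fix \<omega> assume "\<omega> \<in> space M"
    from step[OF this] show "indicator D \<omega> * (test_fun c m p R (y + incr n \<omega>) - test_fun c m p R y)
        \<le> (c / q - 2 * a) * (indicator D \<omega> * (incr n \<omega> \<bullet> y))
        + (c * K\<^sup>2 / (2 * q) + a * \<eta>) * indicator D \<omega>
        - a * (indicator D \<omega> * (e \<bullet> incr n \<omega>)\<^sup>2)"
      by (cases "\<omega> \<in> D") auto
  qed (use i0 i1 i2 in \<open>simp del: of_bool_eq\<close>)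
  also have "\<dots> = (c * K\<^sup>2 / (2 * q) + a * \<eta>) * prob D - a * (\<integral>\<omega>. indicator D \<omega> * (e \<bullet> incr n \<omega>)\<^sup>2 \<partial>M)"
    using i0 i1 i2 DM integral_incr_driftless[OF D, of y] by simp
  also have "\<dots> \<le> (c * K\<^sup>2 / (2 * q) + a * \<eta>) * prob D - a * (h * r\<^sup>2 * prob D)"
    using mult_left_mono[OF integral_incr_square[OF D e(1)] a] by simp
  also have "\<dots> = (c * K\<^sup>2 / (2 * q) - a * \<eta>) * prob D" by (simp add: \<eta>_def algebra_simps)
  also have "\<dots> \<le> (c * K\<^sup>2 / (2 * sqrt m) - a * \<eta>) * prob D"
  proof (intro mult_right_mono diff_right_mono)
    show "c * K\<^sup>2 / (2 * q) \<le> c * K\<^sup>2 / (2 * sqrt m)"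
      using q assms(1) less_le_trans[OF q(2,1)] by (intro divide_left_mono mult_pos_pos) auto
  qed simp
  finally show ?thesis by (simp add: a_def s_def mult.assoc mult.commute mult.left_commute)
qed

lemma norm_X_diff_le:
  assumes "\<omega> \<in> space M" "i \<le> n"
  shows "norm (X n \<omega> - X i \<omega>) \<le> 2 * K * n"
proof -
  have "norm (X n \<omega> - X i \<omega>) \<le> K * n + K * i"
    using norm_X_le[OF assms(1)] norm_triangle_ineq4[of "X n \<omega>" "X i \<omega>"] by (smt (verit))
  also have "\<dots> \<le> 2 * K * n" using assms(2) K_pos by simp
  finally show ?thesis .
qed

lemma X_diff_lattice: "\<omega> \<in> space M \<Longrightarrow> X n \<omega> - X i \<omega> \<in> int_lattice"
  using lattice_valued unfolding int_lattice_def by auto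

lemma meet_F: "i \<le> n \<Longrightarrow> {\<omega> \<in> space M. X n \<omega> = X i \<omega>} \<in> sets (F n)"
proof -
  assume i: "i \<le> n"
  note [measurable] = X_F[OF i] X_F[of n n, simplified]
  have "{\<omega> \<in> space (F n). X n \<omega> - X i \<omega> \<in> {0}} \<in> sets (F n)" by measurable
  then show ?thesis by (simp add: space_F)
qed

lemma integrable_test_fun_X:
  assumes "c \<ge> 0" "m \<ge> 1" "i \<le> n"
  shows "integrable M (\<lambda>\<omega>. test_fun c m p R (X n \<omega> - X i \<omega>))"
  using norm_X_diff_le[OF _ assms(3)] by (intro integrable_test_fun[OF assms(1,2)]) auto

text \<open>Bounded increments leave only finitely many lattice values for the displacement. On each
  of them it is constant, so the orthogonal direction can be chosen deterministically there.\<close>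

lemma integral_test_fun_step_driftless:
  assumes "c \<ge> 0" "m \<ge> 1" and D: "D \<in> sets (F n)" "D \<subseteq> driftless n" and i: "i \<le> n"
  shows "(\<integral>\<omega>. indicator D \<omega> * (test_fun c m p R (X (Suc n) \<omega> - X i \<omega>) - test_fun c m p R (X n \<omega> - X i \<omega>)) \<partial>M)
    \<le> c * K\<^sup>2 / (2 * sqrt m) * prob D - return_gain * prob {\<omega> \<in> D. X n \<omega> = X i \<omega>}"
proof -
  define S :: "(real ^ 'd) set" where "S = {y. y \<in> int_lattice \<and> norm y \<le> 2 * K * n}"
  define E where "E y = {\<omega> \<in> D. X n \<omega> - X i \<omega> = y}" for y
  have DM: "D \<in> sets M" using D F_imp_M by blast
  have Dsp: "D \<subseteq> space M" using sets.sets_into_space[OF DM] .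
  have fS: "finite S" unfolding S_def using K_pos by (intro finite_lattice_ball) auto
  have 0: "0 \<in> S" using K_pos by (simp add: S_def int_lattice_def)
  have EF: "E y \<in> sets (F n)" for y
  proof -
    note [measurable] = X_F[OF i] X_F[of n n, simplified]
    have "D \<inter> {\<omega> \<in> space (F n). X n \<omega> - X i \<omega> \<in> {y}} \<in> sets (F n)" using D(1) by measurable
    also have "D \<inter> {\<omega> \<in> space (F n). X n \<omega> - X i \<omega> \<in> {y}} = E y"
      using Dsp by (auto simp: E_def space_F)
    finally show ?thesis .
  qed
  have EM: "E y \<in> sets M" for y using EF F_imp_M by blast
  have ED: "E y \<subseteq> driftless n" for y using D(2) by (auto simp: E_def)
  have inS: "X n \<omega> - X i \<omega> \<in> S" if "\<omega> \<in> D" for \<omega>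
    using that Dsp norm_X_diff_le[OF _ i] X_diff_lattice by (auto simp: S_def)
  let ?f = "\<lambda>y \<omega>. indicator (E y) \<omega> * (test_fun c m p R (y + incr n \<omega>) - test_fun c m p R y)"
  have int: "integrable M (?f y)" for y
  proof (intro integrable_indicator_mult[OF EM] Bochner_Integration.integrable_diff integrable_test_fun[OF assms(1,2)])
    show "norm (y + incr n \<omega>) \<le> norm y + K" if "\<omega> \<in> space M" for \<omega>
      using norm_incr_le[OF that, of n] norm_triangle_ineq[of y "incr n \<omega>"] by linarith
  qed auto
  have "(\<integral>\<omega>. indicator D \<omega> * (test_fun c m p R (X (Suc n) \<omega> - X i \<omega>) - test_fun c m p R (X n \<omega> - X i \<omega>)) \<partial>M)
      = (\<integral>\<omega>. (\<Sum>y\<in>S. ?f y \<omega>) \<partial>M)"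
  proof (rule Bochner_Integration.integral_cong[OF refl])
    fix \<omega>
    show "indicator D \<omega> * (test_fun c m p R (X (Suc n) \<omega> - X i \<omega>) - test_fun c m p R (X n \<omega> - X i \<omega>))
      = (\<Sum>y\<in>S. ?f y \<omega>)"
    proof (cases "\<omega> \<in> D")
      case True
      let ?y = "X n \<omega> - X i \<omega>"
      have "(\<Sum>y\<in>S. ?f y \<omega>) = (\<Sum>y\<in>S. if y = ?y then ?f ?y \<omega> else 0)"
        by (intro sum.cong) (auto simp: E_def)
      also have "\<dots> = ?f ?y \<omega>" using inS[OF True] fS by simp
      finally show ?thesis using True by (simp add: E_def algebra_simps)
    qed (auto simp: E_def)
  qed
  also have "\<dots> = (\<Sum>y\<in>S. \<integral>\<omega>. ?f y \<omega> \<partial>M)"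
    using int by (rule Bochner_Integration.integral_sum)
  \<comment> \<open>The gain is nonnegative for every y; only y = 0, a return to the site
    \<open>X i\<close>, is kept.\<close>
  also have "\<dots> \<le> (\<Sum>y\<in>S. c * K\<^sup>2 / (2 * sqrt m) * prob (E y) - (if y = 0 then return_gain * prob (E 0) else 0))"
  proof (rule sum_mono)
    fix y
    have "0 \<le> p * \<eta> * (R\<^sup>2 + (norm y)\<^sup>2) powr (p - 1) * prob (E y)" using p eta_pos by simp
    then show "(\<integral>\<omega>. ?f y \<omega> \<partial>M) \<le> c * K\<^sup>2 / (2 * sqrt m) * prob (E y) - (if y = 0 then return_gain * prob (E 0) else 0)"
      using integral_test_fun_step_fixed[OF assms(1,2) EF ED, of y y]
      by (auto simp: return_gain_def left_diff_distrib)
  qed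
  also have "\<dots> = c * K\<^sup>2 / (2 * sqrt m) * (\<Sum>y\<in>S. prob (E y)) - return_gain * prob (E 0)"
    using 0 fS by (simp add: sum_subtractf sum_distrib_left)
  also have "(\<Sum>y\<in>S. prob (E y)) = prob (\<Union>y\<in>S. E y)"
    using fS EM by (intro finite_measure_finite_Union[symmetric]) (auto simp: disjoint_family_on_def E_def)
  also have "(\<Union>y\<in>S. E y) = D" using inS by (auto simp: E_def)
  also have "E 0 = {\<omega> \<in> D. X n \<omega> = X i \<omega>}" by (auto simp: E_def)
  finally show ?thesis .
qed

lemma first_visit_F: "{\<omega> \<in> space M. first_visit X n \<omega>} \<in> sets (F n)"
proof -
  have "{\<omega> \<in> space M. first_visit X n \<omega>} = space (F n) - (\<Union>k<n. {\<omega> \<in> space M. X n \<omega> = X k \<omega>})"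
    by (auto simp: first_visit_def space_F)
  also have "\<dots> \<in> sets (F n)"
    by (intro sets.Diff sets.finite_UN) (auto intro: meet_F)
  finally show ?thesis .
qed

lemma AE_revisit_driftless: "AE \<omega> in M. \<forall>n. \<not> first_visit X n \<omega> \<longrightarrow> \<omega> \<in> driftless n"
  using no_drift AE_space by eventually_elim (auto simp: driftless_def cond_drift_def)

text \<open>Almost surely revisits are driftless, so this charge is levied at first visits only,
  inside \<open>A\<close> or not. Whether a visit is the first is judged by the whole past, while
  the distance is measured from the reference site \<open>X i\<close>.\<close>

definition drift_cost :: "real \<Rightarrow> nat \<Rightarrow> nat \<Rightarrow> 'a \<Rightarrow> real" where
  "drift_cost c i n \<omega> = of_bool (first_visit X n \<omega>) *
    (c * (K + K\<^sup>2) + (2 * K + \<eta>) * (R\<^sup>2 + (norm (X n \<omega> - X i \<omega>))\<^sup>2) powr (p - 1/2))"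

lemma drift_cost_nonneg: "c \<ge> 0 \<Longrightarrow> drift_cost c i n \<omega> \<ge> 0"
  using K_pos eta_pos by (simp add: drift_cost_def)

lemma drift_cost_M: "drift_cost c i n \<in> borel_measurable M"
proof -
  have "{\<omega> \<in> space M. first_visit X n \<omega>} \<in> sets M" using first_visit_F F_imp_M by blast
  then have [measurable]: "Measurable.pred M (\<lambda>\<omega>. first_visit X n \<omega>)" by (simp add: pred_def)
  show ?thesis unfolding drift_cost_def by measurable
qed

lemma integrable_drift_cost:
  assumes "c \<ge> 0"
  shows "integrable M (drift_cost c i n)"
proof (rule integrable_const_bound[OF _ drift_cost_M])
  have "drift_cost c i n \<omega> \<le> c * (K + K\<^sup>2) + (2 * K + \<eta>)" for \<omega>
  proof -
    have "(R\<^sup>2 + (norm (X n \<omega> - X i \<omega>))\<^sup>2) powr (p - 1/2) \<le> 1"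
      using powr_mono2'[of "p - 1/2" 1, OF _ _ base_ge_1] p by simp
    then have "(2 * K + \<eta>) * (R\<^sup>2 + (norm (X n \<omega> - X i \<omega>))\<^sup>2) powr (p - 1/2) \<le> (2 * K + \<eta>)"
      using K_pos eta_pos by (simp add: mult_left_le)
    then show ?thesis using assms K_pos eta_pos by (simp add: drift_cost_def)
  qed
  then show "AE \<omega> in M. norm (drift_cost c i n \<omega>) \<le> c * (K + K\<^sup>2) + (2 * K + \<eta>)"
    using drift_cost_nonneg[OF assms] by (intro AE_I2) simp
qed

lemma integral_test_fun_step:
  assumes "c \<ge> 0" "m \<ge> 1" and D: "D \<in> sets (F n)" and i: "i \<le> n"
  shows "(\<integral>\<omega>. indicator D \<omega> * (test_fun c m p R (X (Suc n) \<omega> - X i \<omega>) - test_fun c m p R (X n \<omega> - X i \<omega>)) \<partial>M)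
    \<le> c * K\<^sup>2 / (2 * sqrt m) * prob D - return_gain * prob {\<omega> \<in> D \<inter> driftless n. X n \<omega> = X i \<omega>}
      + (\<integral>\<omega>. indicator D \<omega> * drift_cost c i n \<omega> \<partial>M)"
proof -
  let ?f = "\<lambda>\<omega>. test_fun c m p R (X (Suc n) \<omega> - X i \<omega>) - test_fun c m p R (X n \<omega> - X i \<omega>)"
  let ?D1 = "D \<inter> driftless n" and ?D2 = "D - driftless n"
  have D1: "?D1 \<in> sets (F n)" using D driftless_F by auto
  have D2: "?D2 \<in> sets (F n)" using D driftless_F by auto
  have M: "D \<in> sets M" "?D1 \<in> sets M" "?D2 \<in> sets M" using F_imp_M D D1 D2 by blast+
  have intf: "integrable M ?f"
    using i by (intro Bochner_Integration.integrable_diff integrable_test_fun_X assms) auto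
  have "(\<integral>\<omega>. indicator D \<omega> * ?f \<omega> \<partial>M) = (\<integral>\<omega>. indicator ?D1 \<omega> * ?f \<omega> + indicator ?D2 \<omega> * ?f \<omega> \<partial>M)"
    by (intro Bochner_Integration.integral_cong) (auto simp: indicator_def)
  also have "\<dots> = (\<integral>\<omega>. indicator ?D1 \<omega> * ?f \<omega> \<partial>M) + (\<integral>\<omega>. indicator ?D2 \<omega> * ?f \<omega> \<partial>M)"
    by (intro Bochner_Integration.integral_add integrable_indicator_mult intf M)
  also have "(\<integral>\<omega>. indicator ?D1 \<omega> * ?f \<omega> \<partial>M) \<le> c * K\<^sup>2 / (2 * sqrt m) * prob ?D1 - return_gain * prob {\<omega> \<in> ?D1. X n \<omega> = X i \<omega>}"
    by (rule integral_test_fun_step_driftless[OF assms(1,2) D1 _ i]) auto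
  also have "c * K\<^sup>2 / (2 * sqrt m) * prob ?D1 \<le> c * K\<^sup>2 / (2 * sqrt m) * prob D"
    using assms(1,2) M by (intro mult_left_mono finite_measure_mono) auto
  \<comment> \<open>Here the bound is pointwise: off \<open>driftless n\<close> the walk almost
    surely stands at a new site, and the worst-case estimate applies whatever the drift.\<close>
  also have "(\<integral>\<omega>. indicator ?D2 \<omega> * ?f \<omega> \<partial>M) \<le> (\<integral>\<omega>. indicator D \<omega> * drift_cost c i n \<omega> \<partial>M)"
  proof (rule integral_mono_AE)
    show "AE \<omega> in M. indicator ?D2 \<omega> * ?f \<omega> \<le> indicator D \<omega> * drift_cost c i n \<omega>"
      using AE_revisit_driftless AE_space
    proof eventually_elim
      case (elim \<omega>)
      show ?case
      proof (cases "\<omega> \<in> ?D2")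
        case True
        with elim have "first_visit X n \<omega>" by blast
        moreover have "X n \<omega> - X i \<omega> + incr n \<omega> = X (Suc n) \<omega> - X i \<omega>" by simp
        ultimately show ?thesis
          using True test_fun_step_drift[OF assms(1,2) norm_incr_le[OF elim(2)], of "X n \<omega> - X i \<omega>" n]
          by (simp add: drift_cost_def)
      next
        case False
        then show ?thesis using drift_cost_nonneg[OF assms(1)] by (simp add: indicator_def)
      qed
    qed
  qed (intro integrable_indicator_mult M intf integrable_drift_cost assms)+
  finally show ?thesis by simp
qed

end

text \<open>Cauchy-Schwarz for the occupation numbers: they sum to \<open>card I\<close> over the
  range, and the sum of their squares counts ordered pairs with equal values, namely the diagonal
  and twice the pairs with i < k.\<close>

lemma card_image_collisions:
  fixes f :: "nat \<Rightarrow> 'b"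
  assumes "finite I"
  shows "(real (card I))\<^sup>2 \<le> real (card (f ` I)) *
    (real (card I) + 2 * (\<Sum>i\<in>I. \<Sum>k\<in>I. of_bool (i < k \<and> f k = f i)))"
proof -
  have "real (card I) = (\<Sum>x\<in>f ` I. \<Sum>i\<in>I. of_bool (f i = x))"
  proof -
    have "(\<Sum>x\<in>f ` I. \<Sum>i\<in>I. of_bool (f i = x)) = (\<Sum>i\<in>I. \<Sum>x\<in>f ` I. of_bool (f i = x) :: real)"
      by (rule sum.swap)
    also have "\<dots> = (\<Sum>i\<in>I. 1)"
    proof (rule sum.cong[OF refl])
      fix i assume "i \<in> I"
      then have "(\<Sum>x\<in>f ` I. of_bool (f i = x)) = (\<Sum>x\<in>f ` I. if x = f i then 1 else 0 :: real)"
        by (intro sum.cong) auto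
      then show "(\<Sum>x\<in>f ` I. of_bool (f i = x)) = (1 :: real)" using \<open>i \<in> I\<close> assms by simp
    qed
    finally show ?thesis by simp
  qed
  then have "(real (card I))\<^sup>2 \<le> real (card (f ` I)) * (\<Sum>x\<in>f ` I. (\<Sum>i\<in>I. of_bool (f i = x))\<^sup>2)"
    using sum_squared_le_sum_of_squares[of "\<lambda>x. \<Sum>i\<in>I. of_bool (f i = x)" "f ` I"] by (simp add: mult.commute)
  also have "(\<Sum>x\<in>f ` I. (\<Sum>i\<in>I. of_bool (f i = x))\<^sup>2 :: real) = (\<Sum>i\<in>I. \<Sum>k\<in>I. of_bool (f k = f i))"
  proof -
    have "(\<Sum>x\<in>f ` I. (\<Sum>i\<in>I. of_bool (f i = x))\<^sup>2 :: real)
        = (\<Sum>x\<in>f ` I. \<Sum>i\<in>I. \<Sum>k\<in>I. of_bool (f i = x) * of_bool (f k = x))"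
      by (simp add: power2_eq_square sum_product)
    also have "\<dots> = (\<Sum>i\<in>I. \<Sum>x\<in>f ` I. \<Sum>k\<in>I. of_bool (f i = x) * of_bool (f k = x))"
      by (rule sum.swap)
    also have "\<dots> = (\<Sum>i\<in>I. \<Sum>k\<in>I. of_bool (f k = f i))"
    proof (rule sum.cong[OF refl])
      fix i assume "i \<in> I"
      have "(\<Sum>x\<in>f ` I. \<Sum>k\<in>I. of_bool (f i = x) * of_bool (f k = x))
          = (\<Sum>x\<in>f ` I. if x = f i then (\<Sum>k\<in>I. of_bool (f k = f i)) else (0::real))"
        by (intro sum.cong) auto
      then show "(\<Sum>x\<in>f ` I. \<Sum>k\<in>I. of_bool (f i = x) * of_bool (f k = x)) = (\<Sum>k\<in>I. of_bool (f k = f i) :: real)"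
        using \<open>i \<in> I\<close> assms by simp
    qed
    finally show ?thesis .
  qed
  also have "\<dots> = (\<Sum>i\<in>I. \<Sum>k\<in>I. of_bool (k = i) + of_bool (i < k \<and> f k = f i) + of_bool (k < i \<and> f k = f i))"
  proof (intro sum.cong refl)
    fix i k
    show "of_bool (f k = f i) = of_bool (k = i) + of_bool (i < k \<and> f k = f i) + (of_bool (k < i \<and> f k = f i) :: real)"
      by (cases i k rule: linorder_cases) auto
  qed
  also have "\<dots> = real (card I) + (\<Sum>i\<in>I. \<Sum>k\<in>I. of_bool (i < k \<and> f k = f i)) + (\<Sum>i\<in>I. \<Sum>k\<in>I. of_bool (k < i \<and> f k = f i))"
    using assms by (simp add: sum.distrib of_bool_def)
  also have "(\<Sum>i\<in>I. \<Sum>k\<in>I. of_bool (k < i \<and> f k = f i)) = (\<Sum>i\<in>I. \<Sum>k\<in>I. of_bool (i < k \<and> f k = f i) :: real)"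
    by (subst sum.swap) (intro sum.cong refl, auto)
  finally show ?thesis by (simp add: algebra_simps)
qed

section \<open>From the number of returns to the number of new sites\<close>

context GERW_potential
begin

text \<open>Times are counted instead of sites; this is the same, since each visited site has one
  first-visit time. A site already seen before \<open>T\<close> is not new.\<close>

definition new_sites :: "nat \<Rightarrow> nat \<Rightarrow> 'a \<Rightarrow> nat" where
  "new_sites T n \<omega> = card {j \<in> {T..<n}. first_visit X j \<omega>}"

lemma new_sites_mono: "k \<le> n \<Longrightarrow> new_sites T k \<omega> \<le> new_sites T n \<omega>"
  unfolding new_sites_def by (intro card_mono) auto

lemma new_sites_F: "(\<lambda>\<omega>. real (new_sites T n \<omega>)) \<in> borel_measurable (F n)"
proof -
  have [measurable]: "Measurable.pred (F n) (first_visit X j)" if "j \<in> {T..<n}" for j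
    using F_mono[OF first_visit_F, of j n] that by (simp add: pred_def space_F)
  have "real (new_sites T n \<omega>) = (\<Sum>j\<in>{T..<n}. if first_visit X j \<omega> then 1 else 0)" for \<omega>
    by (simp add: new_sites_def flip: sum.inter_filter)
  moreover have "(\<lambda>\<omega>. \<Sum>j\<in>{T..<n}. if first_visit X j \<omega> then 1 else 0 :: real) \<in> borel_measurable (F n)"
    by measurable
  ultimately show ?thesis by simp
qed

lemma few_new_sites_F:
  assumes "E \<in> sets (F T)" "T \<le> n"
  shows "{\<omega> \<in> E. real (new_sites T n \<omega>) < N} \<in> sets (F n)"
proof -
  note [measurable] = new_sites_F[of T n]
  have "E \<inter> {\<omega> \<in> space (F n). real (new_sites T n \<omega>) < N} \<in> sets (F n)"
    using F_mono[OF assms] by measurable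
  also have "E \<inter> {\<omega> \<in> space (F n). real (new_sites T n \<omega>) < N} = {\<omega> \<in> E. real (new_sites T n \<omega>) < N}"
    using sets.sets_into_space[OF assms(1)] by (auto simp: space_F)
  finally show ?thesis .
qed

text \<open>The power saved by the lattice sum for t = 1 - 2p. It is the \<theta> of the Taylor
  estimate divided by 2d.\<close>

definition \<theta> :: real where "\<theta> = (1 - 2 * p) / (2 * CARD('d))"

lemma theta: "0 < \<theta>" "\<theta> \<le> 1/2" "\<theta> \<le> 1 - 2 * p"
proof -
  have d: "1 \<le> 2 * real CARD('d)" using dimension by linarith
  show "0 < \<theta>" using p dimension by (simp add: \<theta>_def)
  have "1 - 2 * p \<le> CARD('d)" using p dimension by linarith
  then show "\<theta> \<le> 1/2" using dimension by (simp add: \<theta>_def field_simps)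
  show "\<theta> \<le> 1 - 2 * p"
    using mult_left_mono[OF d, of "1 - 2 * p"] p d unfolding \<theta>_def by (subst pos_divide_le_eq) auto
qed

text \<open>This holds path by path: first visits at different times take place at different lattice
  points, and at most 2N of them are charged, so the lattice sum applies to the
  displacements.\<close>

lemma sum_drift_cost_le:
  assumes "T \<le> i" "c \<ge> 0" "N \<ge> 1" "\<omega> \<in> space M"
  shows "(\<Sum>k=i..<n. of_bool (real (new_sites T k \<omega>) < N) * drift_cost c i k \<omega>)
    \<le> 2 * N * c * (K + K\<^sup>2) + (2 * K + \<eta>) * ((3 ^ CARD('d) + 1) * (2 * N) powr (1 - \<theta>))"
proof -
  define I where "I = {k \<in> {i..<n}. real (new_sites T k \<omega>) < N \<and> first_visit X k \<omega>}"
  have fI: "finite I" by (simp add: I_def)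
  have cI: "real (card I) \<le> 2 * N"
  proof (cases "I = {}")
    case False
    \<comment> \<open>The last charged time lies outside the range counted by
      \<open>new_sites T k\<close>; the extra 1 is absorbed into 2N by N \<ge> 1.\<close>
    define k where "k = Max I"
    have k: "k \<in> I" using False fI by (simp add: k_def)
    have "I \<subseteq> insert k {j \<in> {T..<k}. first_visit X j \<omega>}"
    proof
      fix j assume j: "j \<in> I"
      then have "j \<le> k" using fI by (simp add: k_def)
      with j show "j \<in> insert k {j \<in> {T..<k}. first_visit X j \<omega>}" using assms(1) by (auto simp: I_def)
    qed
    then have "card I \<le> card (insert k {j \<in> {T..<k}. first_visit X j \<omega>})" by (intro card_mono) auto
    also have "\<dots> = Suc (new_sites T k \<omega>)" by (simp add: new_sites_def)
    finally show ?thesis using k assms(3) by (auto simp: I_def)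
  qed (use assms in simp)
  have inj: "inj_on (\<lambda>k. X k \<omega> - X i \<omega>) I"
  proof (rule inj_onI)
    fix a b assume "a \<in> I" "b \<in> I" "X a \<omega> - X i \<omega> = X b \<omega> - X i \<omega>"
    then have "first_visit X a \<omega>" "first_visit X b \<omega>" "X a \<omega> = X b \<omega>" by (auto simp: I_def)
    then show "a = b" unfolding first_visit_def by (metis linorder_neqE_nat)
  qed
  have "(\<Sum>k=i..<n. of_bool (real (new_sites T k \<omega>) < N) * drift_cost c i k \<omega>)
      = (\<Sum>k\<in>I. c * (K + K\<^sup>2) + (2 * K + \<eta>) * (R\<^sup>2 + (norm (X k \<omega> - X i \<omega>))\<^sup>2) powr (p - 1/2))"
    unfolding I_def sum.inter_filter[OF finite_atLeastLessThan]
    by (intro sum.cong refl) (auto simp: drift_cost_def)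
  also have "\<dots> = card I * (c * (K + K\<^sup>2))
      + (2 * K + \<eta>) * (\<Sum>k\<in>I. (R\<^sup>2 + (norm (X k \<omega> - X i \<omega>))\<^sup>2) powr (p - 1/2))"
    by (simp add: sum.distrib sum_distrib_left)
  also have "(\<Sum>k\<in>I. (R\<^sup>2 + (norm (X k \<omega> - X i \<omega>))\<^sup>2) powr (p - 1/2))
      = (\<Sum>x\<in>(\<lambda>k. X k \<omega> - X i \<omega>) ` I. (R\<^sup>2 + (norm x)\<^sup>2) powr (- ((1 - 2 * p) / 2)))"
    using sum.reindex[OF inj, of "\<lambda>x. (R\<^sup>2 + (norm x)\<^sup>2) powr (- ((1 - 2 * p) / 2))"]
    by (simp add: diff_divide_distrib)
  also have "\<dots> \<le> (3 ^ CARD('d) + 1) * (2 * N) powr (1 - (1 - 2 * p) / (2 * CARD('d)))"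
  proof (rule sum_lattice_powr_le)
    show "(\<lambda>k. X k \<omega> - X i \<omega>) ` I \<subseteq> int_lattice" using X_diff_lattice[OF assms(4)] by auto
    show "real (card ((\<lambda>k. X k \<omega> - X i \<omega>) ` I)) \<le> 2 * N" using cI by (simp add: card_image[OF inj])
  qed (use fI p R assms in auto)
  also have "card I * (c * (K + K\<^sup>2)) \<le> 2 * N * (c * (K + K\<^sup>2))"
    using cI assms K_pos by (intro mult_right_mono) auto
  finally show ?thesis using K_pos eta_pos by (simp add: \<theta>_def mult.assoc mult_left_mono)
qed

text \<open>In order: the growth of the square root term over m steps, the two parts of the
  first-visit costs, and the starting value of the shifted test function.\<close>

definition occ_const :: real where
  "occ_const = K\<^sup>2 / 2 + 2 * (K + K\<^sup>2) + 2 * (2 * K + \<eta>) * (3 ^ CARD('d) + 1) + 2 + R"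

lemma occ_const_pos: "occ_const > 0"
  using K_pos eta_pos R unfolding occ_const_def by (simp add: add_pos_pos add_pos_nonneg)

text \<open>The shifted test function is nonnegative, starts at O(N^(2p)), and gains at most
  O(N^(2p)) from the square root and O(N^(1 - \<theta>)) from first visits, while each return lowers
  it on average by \<open>return_gain\<close>. The returns can only consume what was put in.
  Stopping at N new sites is compatible with the filtration because \<open>D k\<close> lies in
  \<open>F k\<close>.\<close>

lemma expected_returns_le:
  assumes Ti: "T \<le> i" "n \<le> i + m" and N: "N \<ge> 1" "sqrt m \<le> N" and m: "m \<ge> (1::nat)"
    and E: "E \<in> sets (F T)"
  shows "return_gain * (\<Sum>k\<in>{i<..<n}. prob {\<omega> \<in> E. real (new_sites T k \<omega>) < N \<and> X k \<omega> = X i \<omega>})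
    \<le> occ_const * N powr (1 - \<theta>) * prob E"
proof (cases "i < n")
  case True
  \<comment> \<open>\<open>c\<close> is chosen so that z^a \<le> N^a + c z for all z \<ge> 0: up to
    N the constant suffices, beyond N one has z^(a - 1) \<le> c. With z = R + q this gives
    nonnegativity, the part c R going into \<open>b\<close>. As c N = N^a and sqrt m \<le> N, the
    square root term costs only O(N^a) in m steps.\<close>
  define a where "a = 2 * p"
  define c where "c = N powr (a - 1)"
  define b where "b = N powr a + c * R"
  define t where "t k \<omega> = test_fun c m p R (X k \<omega> - X i \<omega>)" for k \<omega>
  define D where "D k = {\<omega> \<in> E. real (new_sites T k \<omega>) < N}" for k
  have c0: "c \<ge> 0" by (simp add: c_def)
  have m1: "real m \<ge> 1" using m by simp
  have EM: "E \<in> sets M" using E F_imp_M by blast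
  have Esp: "E \<subseteq> space M" using sets.sets_into_space[OF EM] .
  have DF: "D k \<in> sets (F k)" if "i \<le> k" for k
    unfolding D_def using few_new_sites_F[OF E] that Ti by simp
  have DM: "D k \<in> sets M" if "i \<le> k" for k using DF[OF that] F_imp_M by blast
  have cN: "c * N = N powr a" using N by (simp add: c_def powr_diff)
  have cm: "c * sqrt m \<le> N powr a" using mult_left_mono[OF N(2) c0] cN by simp
  have phi_nonneg: "b + t k \<omega> \<ge> 0" for k \<omega>
  proof -
    define y where "y = X k \<omega> - X i \<omega>"
    define q where "q = sqrt (m + (norm y)\<^sup>2)"
    have q: "q \<ge> 0" "norm y \<le> q" unfolding q_def by (auto intro!: real_le_rsqrt)
    have "R\<^sup>2 + (norm y)\<^sup>2 \<le> (R + q)\<^sup>2"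
    proof -
      have "(norm y)\<^sup>2 \<le> q\<^sup>2" using q by (simp add: power_mono)
      moreover have "R * q \<ge> 0" using R q by simp
      ultimately show ?thesis by (simp add: power2_sum)
    qed
    then have "(R\<^sup>2 + (norm y)\<^sup>2) powr p \<le> ((R + q)\<^sup>2) powr p"
      using p base_pos[of y] by (intro powr_mono2) auto
    also have "\<dots> = (R + q) powr a" using R q by (simp add: a_def powr_powr flip: powr_numeral)
    also have "\<dots> \<le> N powr a + c * (R + q)"
    proof (cases "R + q \<le> N")
      case True
      then have "(R + q) powr a \<le> N powr a" using p R q by (intro powr_mono2) (auto simp: a_def)
      moreover have "0 \<le> c * (R + q)" using c0 R q by simp
      ultimately show ?thesis by linarith
    next
      case False
      have "(R + q) powr a = (R + q) powr (a - 1) * (R + q)" using R q by (simp add: powr_diff)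
      also have "\<dots> \<le> c * (R + q)" unfolding c_def
        using False N p R q by (intro mult_right_mono powr_mono2') (auto simp: a_def)
      finally show ?thesis by (smt (verit) powr_ge_zero)
    qed
    finally show ?thesis by (simp add: b_def t_def test_fun_def y_def[symmetric] q_def[symmetric] algebra_simps)
  qed
  have start_le: "b + t i \<omega> \<le> b + c * sqrt m" for \<omega>
    by (simp add: t_def test_fun_def)
  let ?P = "\<lambda>k. prob {\<omega> \<in> D k \<inter> driftless k. X k \<omega> = X i \<omega>}"
  have int_t: "integrable M (\<lambda>\<omega>. t (Suc k) \<omega> - t k \<omega>)" if "i \<le> k" for k
    unfolding t_def using that by (intro Bochner_Integration.integrable_diff integrable_test_fun_X c0 m1) auto
  have int1: "integrable M (\<lambda>\<omega>. \<Sum>k=i..<n. indicator (D k) \<omega> * (t (Suc k) \<omega> - t k \<omega>))"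
    by (intro Bochner_Integration.integrable_sum integrable_indicator_mult DM int_t) auto
  have int2: "integrable M (\<lambda>\<omega>. \<Sum>k=i..<n. indicator (D k) \<omega> * drift_cost c i k \<omega>)"
    by (intro Bochner_Integration.integrable_sum integrable_indicator_mult DM integrable_drift_cost c0) auto
  have intE: "integrable M (\<lambda>\<omega>. z * indicat_real E \<omega>)" for z using EM by (simp add: emeasure_eq_measure)
  have "- (b + c * sqrt m) * prob E = (\<integral>\<omega>. - (b + c * sqrt m) * indicator E \<omega> \<partial>M)" using EM by simp
  also have "\<dots> \<le> (\<integral>\<omega>. (\<Sum>k=i..<n. indicator (D k) \<omega> * (t (Suc k) \<omega> - t k \<omega>)) \<partial>M)"
  proof (rule integral_mono[OF intE int1])
    fix \<omega>
    show "- (b + c * sqrt m) * indicator E \<omega> \<le> (\<Sum>k=i..<n. indicator (D k) \<omega> * (t (Suc k) \<omega> - t k \<omega>))"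
    proof (cases "\<omega> \<in> E")
      case True
      have "(\<Sum>k=i..<n. indicator (D k) \<omega> * (t (Suc k) \<omega> - t k \<omega>))
        = (\<Sum>k=i..<n. of_bool (real (new_sites T k \<omega>) < N) * ((b + t (Suc k) \<omega>) - (b + t k \<omega>)))"
        using True by (intro sum.cong) (auto simp: D_def)
      also have "\<dots> \<ge> - (b + t i \<omega>)"
      proof (rule stopped_sum_ge)
        fix k assume "real (new_sites T (Suc k) \<omega>) < N"
        then show "real (new_sites T k \<omega>) < N" using new_sites_mono[of k "Suc k" T \<omega>] by simp
      qed (use phi_nonneg \<open>i < n\<close> in auto)
      finally show ?thesis using start_le[of \<omega>] True by simp
    qed (simp add: D_def)
  qed
  also have "\<dots> = (\<Sum>k=i..<n. \<integral>\<omega>. indicator (D k) \<omega> * (t (Suc k) \<omega> - t k \<omega>) \<partial>M)"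
    by (intro Bochner_Integration.integral_sum integrable_indicator_mult DM int_t) auto
  also have "\<dots> \<le> (\<Sum>k=i..<n. c * K\<^sup>2 / (2 * sqrt m) * prob E - return_gain * ?P k
      + (\<integral>\<omega>. indicator (D k) \<omega> * drift_cost c i k \<omega> \<partial>M))"
  proof (rule sum_mono)
    fix k assume k: "k \<in> {i..<n}"
    have "c * K\<^sup>2 / (2 * sqrt m) * prob (D k) \<le> c * K\<^sup>2 / (2 * sqrt m) * prob E"
      using c0 EM by (intro mult_left_mono finite_measure_mono) (auto simp: D_def)
    then show "(\<integral>\<omega>. indicator (D k) \<omega> * (t (Suc k) \<omega> - t k \<omega>) \<partial>M) \<le>
      c * K\<^sup>2 / (2 * sqrt m) * prob E - return_gain * ?P k + (\<integral>\<omega>. indicator (D k) \<omega> * drift_cost c i k \<omega> \<partial>M)"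
      using integral_test_fun_step[OF c0 m1 DF, of k i] k unfolding t_def by simp
  qed
  also have "\<dots> = real (n - i) * (c * K\<^sup>2 / (2 * sqrt m)) * prob E - return_gain * (\<Sum>k=i..<n. ?P k)
      + (\<integral>\<omega>. (\<Sum>k=i..<n. indicator (D k) \<omega> * drift_cost c i k \<omega>) \<partial>M)"
    by (subst Bochner_Integration.integral_sum)
      (auto simp: sum.distrib sum_subtractf sum_distrib_left intro!: integrable_indicator_mult DM integrable_drift_cost c0)
  also have "(\<integral>\<omega>. (\<Sum>k=i..<n. indicator (D k) \<omega> * drift_cost c i k \<omega>) \<partial>M)
      \<le> (\<integral>\<omega>. (2 * N * c * (K + K\<^sup>2) + (2 * K + \<eta>) * ((3 ^ CARD('d) + 1) * (2 * N) powr (1 - \<theta>))) * indicator E \<omega> \<partial>M)"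
  proof (rule integral_mono[OF int2 intE])
    fix \<omega> assume om: "\<omega> \<in> space M"
    show "(\<Sum>k=i..<n. indicator (D k) \<omega> * drift_cost c i k \<omega>)
      \<le> (2 * N * c * (K + K\<^sup>2) + (2 * K + \<eta>) * ((3 ^ CARD('d) + 1) * (2 * N) powr (1 - \<theta>))) * indicator E \<omega>"
    proof (cases "\<omega> \<in> E")
      case True
      have "(\<Sum>k=i..<n. indicator (D k) \<omega> * drift_cost c i k \<omega>)
        = (\<Sum>k=i..<n. of_bool (real (new_sites T k \<omega>) < N) * drift_cost c i k \<omega>)"
        using True by (intro sum.cong) (auto simp: D_def)
      then show ?thesis using sum_drift_cost_le[OF Ti(1) c0 N(1) om, of n] True by simp
    qed (simp add: D_def)
  qed
  also have "\<dots> = (2 * N * c * (K + K\<^sup>2) + (2 * K + \<eta>) * ((3 ^ CARD('d) + 1) * (2 * N) powr (1 - \<theta>))) * prob E"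
    using EM by simp
  finally have main: "return_gain * (\<Sum>k=i..<n. ?P k) \<le> (real (n - i) * (c * K\<^sup>2 / (2 * sqrt m))
      + (2 * N * c * (K + K\<^sup>2) + (2 * K + \<eta>) * ((3 ^ CARD('d) + 1) * (2 * N) powr (1 - \<theta>)))
      + (b + c * sqrt m)) * prob E"
    by (simp add: algebra_simps)
  have "real (n - i) * (c * K\<^sup>2 / (2 * sqrt m)) + (2 * N * c * (K + K\<^sup>2) + (2 * K + \<eta>) * ((3 ^ CARD('d) + 1) * (2 * N) powr (1 - \<theta>)))
      + (b + c * sqrt m) \<le> occ_const * N powr (1 - \<theta>)"
  proof -
    have pa: "N powr a \<le> N powr (1 - \<theta>)"
      using N theta by (intro powr_mono) (auto simp: a_def)
    have "real (n - i) * (c * K\<^sup>2 / (2 * sqrt m)) \<le> real m * (c * K\<^sup>2 / (2 * sqrt m))"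
      using Ti c0 by (intro mult_right_mono) auto
    also have "\<dots> = K\<^sup>2 / 2 * (c * (real m / sqrt m))" by simp
    also have "real m / sqrt m = sqrt m" by (simp add: real_div_sqrt)
    also have "K\<^sup>2 / 2 * (c * sqrt m) \<le> K\<^sup>2 / 2 * N powr (1 - \<theta>)"
      using cm pa by (intro mult_left_mono) auto
    finally have 1: "real (n - i) * (c * K\<^sup>2 / (2 * sqrt m)) \<le> K\<^sup>2 / 2 * N powr (1 - \<theta>)" .
    have "2 * N * c * (K + K\<^sup>2) = 2 * (K + K\<^sup>2) * N powr a"
      unfolding cN[symmetric] by (simp only: mult.assoc mult.left_commute mult.commute)
    also have "\<dots> \<le> 2 * (K + K\<^sup>2) * N powr (1 - \<theta>)" using pa K_pos by (intro mult_left_mono) auto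
    finally have 2: "2 * N * c * (K + K\<^sup>2) \<le> 2 * (K + K\<^sup>2) * N powr (1 - \<theta>)" .
    have "(2 * N) powr (1 - \<theta>) = 2 powr (1 - \<theta>) * N powr (1 - \<theta>)" using N by (simp add: powr_mult)
    also have "\<dots> \<le> 2 powr 1 * N powr (1 - \<theta>)" using theta by (intro mult_right_mono powr_mono) auto
    finally have "(2 * K + \<eta>) * ((3 ^ CARD('d) + 1) * (2 * N) powr (1 - \<theta>)) \<le> (2 * K + \<eta>) * ((3 ^ CARD('d) + 1) * (2 * N powr (1 - \<theta>)))"
      using K_pos eta_pos by (intro mult_left_mono) auto
    then have 3: "(2 * K + \<eta>) * ((3 ^ CARD('d) + 1) * (2 * N) powr (1 - \<theta>)) \<le> 2 * (2 * K + \<eta>) * (3 ^ CARD('d) + 1) * N powr (1 - \<theta>)"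
      by (simp only: mult.assoc mult.left_commute[of _ 2])
    have "c \<le> N powr a" unfolding c_def using N by (intro powr_mono) auto
    then have "R * c \<le> R * N powr (1 - \<theta>)" using pa R by (intro mult_left_mono) auto
    then have 4: "b + c * sqrt m \<le> (2 + R) * N powr (1 - \<theta>)"
      using pa cm by (simp add: b_def algebra_simps)
    from 1 2 3 4 show ?thesis unfolding occ_const_def distrib_right by linarith
  qed
  then have "(real (n - i) * (c * K\<^sup>2 / (2 * sqrt m)) + (2 * N * c * (K + K\<^sup>2) + (2 * K + \<eta>) * ((3 ^ CARD('d) + 1) * (2 * N) powr (1 - \<theta>)))
      + (b + c * sqrt m)) * prob E \<le> occ_const * N powr (1 - \<theta>) * prob E"
    by (rule mult_right_mono) simp
  with main have "return_gain * (\<Sum>k=i..<n. ?P k) \<le> occ_const * N powr (1 - \<theta>) * prob E" by linarith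
  moreover have "(\<Sum>k\<in>{i<..<n}. prob {\<omega> \<in> E. real (new_sites T k \<omega>) < N \<and> X k \<omega> = X i \<omega>}) \<le> (\<Sum>k=i..<n. ?P k)"
  proof -
    have "(\<Sum>k\<in>{i<..<n}. prob {\<omega> \<in> E. real (new_sites T k \<omega>) < N \<and> X k \<omega> = X i \<omega>}) = (\<Sum>k\<in>{i<..<n}. ?P k)"
    proof (rule sum.cong[OF refl])
      fix k assume k: "k \<in> {i<..<n}"
      have meas: "{\<omega> \<in> Q. X k \<omega> = X i \<omega>} \<in> sets M" if Q: "Q \<in> sets M" for Q
      proof -
        have "{\<omega> \<in> Q. X k \<omega> = X i \<omega>} = Q \<inter> {\<omega> \<in> space M. X k \<omega> = X i \<omega>}"
          using sets.sets_into_space[OF Q] by auto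
        then show ?thesis using Q F_imp_M[OF meet_F, of i k] k by auto
      qed
      have eq: "{\<omega> \<in> E. real (new_sites T k \<omega>) < N \<and> X k \<omega> = X i \<omega>} = {\<omega> \<in> D k. X k \<omega> = X i \<omega>}"
        by (auto simp: D_def)
      show "prob {\<omega> \<in> E. real (new_sites T k \<omega>) < N \<and> X k \<omega> = X i \<omega>} = ?P k"
        unfolding eq
      proof (rule finite_measure_eq_AE)
        \<comment> \<open>A meeting at a time k > i is a revisit, so intersecting with
          \<open>driftless k\<close> removes a null set only.\<close>
        show "AE \<omega> in M. (\<omega> \<in> {\<omega> \<in> D k. X k \<omega> = X i \<omega>}) = (\<omega> \<in> {\<omega> \<in> D k \<inter> driftless k. X k \<omega> = X i \<omega>})"
          using AE_revisit_driftless
        proof eventually_elim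
          case (elim \<omega>)
          then show ?case using k by (auto simp: first_visit_def) metis
        qed
        show "{\<omega> \<in> D k. X k \<omega> = X i \<omega>} \<in> sets M" using k by (intro meas DM) auto
        show "{\<omega> \<in> D k \<inter> driftless k. X k \<omega> = X i \<omega>} \<in> sets M"
          using k F_imp_M[OF driftless_F] by (intro meas sets.Int DM) auto
      qed
    qed
    also have "\<dots> \<le> (\<Sum>k=i..<n. ?P k)" by (intro sum_mono2) auto
    finally show ?thesis .
  qed
  ultimately show ?thesis using mult_left_mono[OF _ less_imp_le[OF return_gain_pos]] by (meson order.trans)
next
  case False
  then have "{i<..<n} = {}" by auto
  then show ?thesis using occ_const_pos by simp
qed

text \<open>A site seen in the window was first visited before \<open>T\<close> (at most T \<le> N
  sites) or within the window (fewer than N), so the range has at most 2N points. By 4N \<le> m the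
  diagonal pairs account for at most half of m^2 in the Cauchy-Schwarz bound.\<close>

lemma many_collisions:
  assumes "real T \<le> N" "4 * N \<le> real m" "real (new_sites T (T + m) \<omega>) < N"
  shows "(real m)\<^sup>2 / (8 * N) \<le> (\<Sum>i=T..<T + m. \<Sum>k=T..<T + m. of_bool (i < k \<and> X k \<omega> = X i \<omega>))"
proof -
  let ?I = "{T..<T + m}"
  let ?Q = "\<Sum>i\<in>?I. \<Sum>k\<in>?I. of_bool (i < k \<and> X k \<omega> = X i \<omega>) :: real"
  let ?S = "{j \<in> ?I. first_visit X j \<omega>}"
  have N: "N > 0" using assms(3) by linarith
  have "(\<lambda>k. X k \<omega>) ` ?I \<subseteq> (\<lambda>k. X k \<omega>) ` ({..<T} \<union> ?S)"
  proof
    fix x assume "x \<in> (\<lambda>k. X k \<omega>) ` ?I"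
    then obtain k where k: "k \<in> ?I" "X k \<omega> = x" by auto
    define j where "j = (LEAST j. X j \<omega> = x)"
    have j: "X j \<omega> = x" "j \<le> k"
      unfolding j_def using k(2) by (rule LeastI, rule Least_le)
    have "X i \<omega> \<noteq> x" if "i < j" for i
      using not_less_Least[of i "\<lambda>j. X j \<omega> = x"] that unfolding j_def by blast
    then have "first_visit X j \<omega>" using j(1) by (simp add: first_visit_def)
    then have "j \<in> {..<T} \<union> ?S" using j k by auto
    then show "x \<in> (\<lambda>k. X k \<omega>) ` ({..<T} \<union> ?S)" using j(1) by blast
  qed
  then have "card ((\<lambda>k. X k \<omega>) ` ?I) \<le> card ((\<lambda>k. X k \<omega>) ` ({..<T} \<union> ?S))" by (intro card_mono) auto
  also have "\<dots> \<le> card ({..<T} \<union> ?S)" by (intro card_image_le) auto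
  also have "\<dots> \<le> T + new_sites T (T + m) \<omega>"
    using card_Un_le[of "{..<T}" ?S] by (simp add: new_sites_def)
  finally have "real (card ((\<lambda>k. X k \<omega>) ` ?I)) \<le> 2 * N" using assms by linarith
  then have "real (card ((\<lambda>k. X k \<omega>) ` ?I)) * (real m + 2 * ?Q) \<le> 2 * N * (real m + 2 * ?Q)"
    by (intro mult_right_mono add_nonneg_nonneg mult_nonneg_nonneg sum_nonneg) auto
  with card_image_collisions[of ?I "\<lambda>k. X k \<omega>"] have "(real m)\<^sup>2 \<le> 2 * N * (real m + 2 * ?Q)" by simp
  moreover have "4 * N * real m \<le> (real m)\<^sup>2"
    using mult_right_mono[OF assms(2), of "real m"] by (simp add: power2_eq_square)
  ultimately have "(real m)\<^sup>2 \<le> 8 * N * ?Q" by (simp add: algebra_simps)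
  then show ?thesis using N by (simp add: field_simps)
qed

text \<open>Markov's inequality: the event forces m^2 / (8N) collisions, whereas their expected
  number before the stopping is O(m N^(1 - \<theta>)) P(E).\<close>

lemma prob_few_new_sites:
  assumes N: "N \<ge> 1" "sqrt m \<le> N" "real T \<le> N" "4 * N \<le> real m" and E: "E \<in> sets (F T)"
  shows "prob {\<omega> \<in> E. real (new_sites T (T + m) \<omega>) < N} \<le> 8 * occ_const / return_gain * N powr (2 - \<theta>) / m * prob E"
proof -
  let ?I = "{T..<T + m}"
  let ?G = "{\<omega> \<in> E. real (new_sites T (T + m) \<omega>) < N}"
  let ?H = "\<lambda>i k. {\<omega> \<in> E. real (new_sites T k \<omega>) < N \<and> X k \<omega> = X i \<omega>}"
  have m: "m \<ge> 1" "real m > 0" using N by auto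
  have EM: "E \<in> sets M" using E F_imp_M by blast
  have G: "?G \<in> sets M" by (rule F_imp_M[OF few_new_sites_F[OF E]]) simp
  have H: "?H i k \<in> sets M" if "T \<le> i" "i \<le> k" for i k
  proof -
    have "?H i k = {\<omega> \<in> E. real (new_sites T k \<omega>) < N} \<inter> {\<omega> \<in> space M. X k \<omega> = X i \<omega>}"
      using sets.sets_into_space[OF EM] by auto
    also have "\<dots> \<in> sets (F k)" using that few_new_sites_F[OF E, of k N] meet_F[of i k] by auto
    finally show ?thesis using F_imp_M by blast
  qed
  have "(real m)\<^sup>2 / (8 * N) * prob ?G = (\<integral>\<omega>. (real m)\<^sup>2 / (8 * N) * indicator ?G \<omega> \<partial>M)" using G by simp
  also have "\<dots> \<le> (\<integral>\<omega>. (\<Sum>i\<in>?I. \<Sum>k\<in>{i<..<T + m}. indicator (?H i k) \<omega>) \<partial>M)"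
  proof (rule integral_mono)
    show "integrable M (\<lambda>\<omega>. (real m)\<^sup>2 / (8 * N) * indicat_real ?G \<omega>)" using G by (simp add: emeasure_eq_measure)
    show "integrable M (\<lambda>\<omega>. \<Sum>i\<in>?I. \<Sum>k\<in>{i<..<T + m}. indicat_real (?H i k) \<omega>)"
      using H by (intro Bochner_Integration.integrable_sum) (auto simp: emeasure_eq_measure)
    fix \<omega>
    show "(real m)\<^sup>2 / (8 * N) * indicat_real ?G \<omega> \<le> (\<Sum>i\<in>?I. \<Sum>k\<in>{i<..<T + m}. indicator (?H i k) \<omega>)"
    proof (cases "\<omega> \<in> ?G")
      case True
      then have "(real m)\<^sup>2 / (8 * N) * indicat_real ?G \<omega> \<le> (\<Sum>i\<in>?I. \<Sum>k\<in>?I. of_bool (i < k \<and> X k \<omega> = X i \<omega>))"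
        using many_collisions[OF N(3,4)] by simp
      also have "\<dots> = (\<Sum>i\<in>?I. \<Sum>k\<in>{i<..<T + m}. indicator (?H i k) \<omega>)"
      proof (rule sum.cong[OF refl])
        fix i assume i: "i \<in> ?I"
        have "(\<Sum>k\<in>?I. of_bool (i < k \<and> X k \<omega> = X i \<omega>)) = (\<Sum>k\<in>{i<..<T + m}. of_bool (i < k \<and> X k \<omega> = X i \<omega>) :: real)"
          using i by (intro sum.mono_neutral_right) auto
        also have "\<dots> = (\<Sum>k\<in>{i<..<T + m}. indicator (?H i k) \<omega>)"
        proof (rule sum.cong[OF refl])
          fix k assume k: "k \<in> {i<..<T + m}"
          \<comment> \<open>Few new sites at the end of the window mean few at each earlier time, so
            the stopped return events miss no collision.\<close>
          then have "new_sites T k \<omega> \<le> new_sites T (T + m) \<omega>" by (intro new_sites_mono) auto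
          then show "of_bool (i < k \<and> X k \<omega> = X i \<omega>) = indicat_real (?H i k) \<omega>" using True k by (auto simp: indicator_def)
        qed
        finally show "(\<Sum>k\<in>?I. of_bool (i < k \<and> X k \<omega> = X i \<omega>)) = (\<Sum>k\<in>{i<..<T + m}. indicat_real (?H i k) \<omega>)" .
      qed
      finally show ?thesis .
    qed (auto intro!: sum_nonneg)
  qed
  also have "\<dots> = (\<Sum>i\<in>?I. \<Sum>k\<in>{i<..<T + m}. prob (?H i k))"
    using H by (subst Bochner_Integration.integral_sum) (auto simp: emeasure_eq_measure intro!: sum.cong)
  also have "\<dots> \<le> (\<Sum>i\<in>?I. occ_const / return_gain * N powr (1 - \<theta>) * prob E)"
  proof (rule sum_mono)
    fix i assume "i \<in> ?I"
    then show "(\<Sum>k\<in>{i<..<T + m}. prob (?H i k)) \<le> occ_const / return_gain * N powr (1 - \<theta>) * prob E"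
      using expected_returns_le[of T i "T + m" m N E] N m E return_gain_pos by (simp add: field_simps)
  qed
  also have "\<dots> = m * (occ_const / return_gain * N powr (1 - \<theta>) * prob E)" by simp
  finally have "8 * N / (real m)\<^sup>2 * ((real m)\<^sup>2 / (8 * N) * prob ?G)
      \<le> 8 * N / (real m)\<^sup>2 * (m * (occ_const / return_gain * N powr (1 - \<theta>) * prob E))"
    using N by (intro mult_left_mono) auto
  also have "8 * N / (real m)\<^sup>2 * ((real m)\<^sup>2 / (8 * N) * prob ?G) = prob ?G" using N m by simp
  finally have "prob ?G \<le> 8 * N / (real m)\<^sup>2 * (m * (occ_const / return_gain * N powr (1 - \<theta>) * prob E))" .
  also have "8 * N / (real m)\<^sup>2 * (m * (occ_const / return_gain * N powr (1 - \<theta>) * prob E)) = 8 * occ_const / return_gain * (N * N powr (1 - \<theta>)) / m * prob E"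
    using m return_gain_pos by (simp add: power2_eq_square field_simps)
  also have "N * N powr (1 - \<theta>) = N powr (2 - \<theta>)"
    using N powr_add[of N 1 "1 - \<theta>"] by simp
  finally show ?thesis .
qed

end

section \<open>The martingale part and the initial climb\<close>

text \<open>\<open>W\<close> is \<open>S\<close> stopped when |S| first reaches x, and it stays
  frozen there. A bound on the final second moment of \<open>W\<close> thus controls the running
  maximum of \<open>S\<close>.\<close>

lemma stopped_sum_maximal:
  fixes d S :: "nat \<Rightarrow> real"
  assumes S: "\<And>n. S n = (\<Sum>k=T..<n. d k)" and "x > 0" "T \<le> n"
  defines "W \<equiv> \<lambda>n. \<Sum>k=T..<n. of_bool (\<forall>j\<in>{T..k}. \<bar>S j\<bar> < x) * d k"
  shows "if \<forall>j\<in>{T..n}. \<bar>S j\<bar> < x then W n = S n else \<bar>W n\<bar> \<ge> x"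
  using \<open>T \<le> n\<close>
proof (induction n rule: dec_induct)
  case base
  then show ?case using \<open>x > 0\<close> by (simp add: W_def S)
next
  case (step n)
  have W: "W (Suc n) = W n + of_bool (\<forall>j\<in>{T..n}. \<bar>S j\<bar> < x) * d n"
    unfolding W_def using step.hyps(1) by (rule sum.atLeastLessThan_Suc)
  have S': "S (Suc n) = S n + d n" using step.hyps by (simp add: S)
  have "{T..Suc n} = insert (Suc n) {T..n}" using step.hyps by auto
  then show ?case using step.IH W S' by (cases "\<forall>j\<in>{T..n}. \<bar>S j\<bar> < x") auto
qed

context GERW
begin

definition mart_step :: "nat \<Rightarrow> 'a \<Rightarrow> real" where
  "mart_step n \<omega> = (incr n \<omega> - cond_drift n \<omega>) \<bullet> l"

definition mart :: "nat \<Rightarrow> nat \<Rightarrow> 'a \<Rightarrow> real" where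
  "mart T n \<omega> = (\<Sum>k=T..<n. mart_step k \<omega>)"

lemma mart_step_F: "k < n \<Longrightarrow> mart_step k \<in> borel_measurable (F n)"
proof -
  assume k: "k < n"
  have [measurable]: "X k \<in> borel_measurable (F n)" "X (Suc k) \<in> borel_measurable (F n)"
    "(\<lambda>\<omega>. cond_drift k \<omega> \<bullet> l) \<in> borel_measurable (F n)"
    using k measurable_F_mono[OF cond_drift_inner_F, of k n l] by (auto intro!: X_F)
  show ?thesis unfolding mart_step_def inner_diff_left[of "incr k _"] by measurable
qed

lemma mart_F: "n \<le> m \<Longrightarrow> mart T n \<in> borel_measurable (F m)"
  unfolding mart_def by (intro borel_measurable_sum mart_step_F) auto

text \<open>K for the increment plus d K for the conditional drift, each component of which is at
  most K in absolute value.\<close>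

definition step_bound :: real where "step_bound = (CARD('d) + 1) * K"

lemma AE_abs_mart_step_le: "AE \<omega> in M. \<bar>mart_step n \<omega>\<bar> \<le> step_bound"
proof -
  have "AE \<omega> in M. \<bar>cond_drift n \<omega> $ i\<bar> \<le> K" for i
  proof -
    have "AE \<omega> in M. real_cond_exp M (F n) (\<lambda>\<omega>. incr n \<omega> $ i) \<omega> \<le> K"
      using incr_comp_bound[of _ n i] by (intro FF.real_cond_exp_le_c integrable_incr_comp AE_I2) fastforce
    moreover have "AE \<omega> in M. real_cond_exp M (F n) (\<lambda>\<omega>. incr n \<omega> $ i) \<omega> \<ge> - K"
      using incr_comp_bound[of _ n i] by (intro FF.real_cond_exp_ge_c integrable_incr_comp AE_I2) fastforce
    ultimately show ?thesis unfolding cond_drift_comp by eventually_elim linarith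
  qed
  then have "AE \<omega> in M. \<forall>i. \<bar>cond_drift n \<omega> $ i\<bar> \<le> K"
    by (subst AE_all_countable) auto
  with AE_space show ?thesis
  proof eventually_elim
    case (elim \<omega>)
    have "norm (cond_drift n \<omega>) \<le> (\<Sum>i\<in>UNIV. \<bar>cond_drift n \<omega> $ i\<bar>)" by (rule norm_le_l1_cart)
    also have "\<dots> \<le> (\<Sum>i\<in>(UNIV :: 'd set). K)" using elim by (intro sum_mono) auto
    finally have "norm (incr n \<omega> - cond_drift n \<omega>) \<le> step_bound"
      using norm_triangle_ineq4[of "incr n \<omega>" "cond_drift n \<omega>"] norm_incr_le[OF elim(1), of n]
      by (simp add: step_bound_def algebra_simps)
    then show ?case
      using Cauchy_Schwarz_ineq2[of "incr n \<omega> - cond_drift n \<omega>" l] direction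
      by (simp add: mart_step_def)
  qed
qed

text \<open>Orthogonality of martingale increments: the past \<open>V\<close> is
  \<open>F n\<close>-measurable and almost surely bounded, so its product with the next step has
  mean 0. Keeping the indicator of \<open>E\<close> inside \<open>V\<close> produces the factor
  P(E).\<close>

lemma integral_stopped_square_le:
  fixes m :: nat
  assumes E: "E \<in> sets (F T)" and B: "\<And>k. k \<ge> T \<Longrightarrow> B k \<in> sets (F k)"
  defines "W \<equiv> \<lambda>n \<omega>. \<Sum>k=T..<n. indicator (B k) \<omega> * mart_step k \<omega>"
  shows "integrable M (\<lambda>\<omega>. indicator E \<omega> * (W (T + m) \<omega>)\<^sup>2) \<and>
    (\<integral>\<omega>. indicator E \<omega> * (W (T + m) \<omega>)\<^sup>2 \<partial>M) \<le> m * step_bound\<^sup>2 * prob E"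
proof (induction m)
  case 0
  have "W T \<omega> = 0" for \<omega> unfolding W_def atLeastLessThan_empty[OF order.refl] by (rule sum.empty)
  then show ?case by simp
next
  case (Suc m)
  define n where "n = T + m"
  define V where "V \<omega> = indicator E \<omega> * (indicator (B n) \<omega> * W n \<omega>)" for \<omega>
  have Tn: "T \<le> n" by (simp add: n_def)
  have EM: "E \<in> sets M" using E F_imp_M by blast
  have BM: "B k \<in> sets M" if "k \<ge> T" for k using B[OF that] F_imp_M by blast
  have WF: "W k \<in> borel_measurable (F k)" for k
  proof -
    have "(\<lambda>\<omega>. indicat_real (B j) \<omega> * mart_step j \<omega>) \<in> borel_measurable (F k)" if "j \<in> {T..<k}" for j
      using that F_mono[OF B, of j k] by (intro borel_measurable_times mart_step_F borel_measurable_indicator) auto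
    then show ?thesis unfolding W_def by (intro borel_measurable_sum) auto
  qed
  have Wb: "AE \<omega> in M. \<bar>W k \<omega>\<bar> \<le> real (k - T) * step_bound" for k
  proof -
    have "AE \<omega> in M. \<forall>j. \<bar>mart_step j \<omega>\<bar> \<le> step_bound"
      using AE_abs_mart_step_le by (subst AE_all_countable) auto
    then show ?thesis
    proof eventually_elim
      case (elim \<omega>)
      have "step_bound \<ge> 0" using K_pos by (simp add: step_bound_def)
      then have "\<bar>indicator (B j) \<omega> * mart_step j \<omega>\<bar> \<le> step_bound" for j
        using elim by (auto simp: indicator_def)
      then have "\<bar>W k \<omega>\<bar> \<le> (\<Sum>j=T..<k. step_bound)"
        unfolding W_def by (intro order.trans[OF sum_abs] sum_mono)
      then show ?case by simp
    qed
  qed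
  have VF: "V \<in> borel_measurable (F n)"
    unfolding V_def using F_mono[OF E Tn] B[OF Tn] WF by (intro borel_measurable_times borel_measurable_indicator)
  have intV: "integrable M V"
  proof (rule integrable_const_bound[where B = "real (n - T) * step_bound"])
    show "AE \<omega> in M. norm (V \<omega>) \<le> real (n - T) * step_bound"
      using Wb[of n] by eventually_elim (use K_pos in \<open>auto simp: V_def indicator_def step_bound_def\<close>)
  qed (rule measurable_F_imp_M[OF VF])
  have Vd: "V \<omega> * mart_step n \<omega> = V \<omega> * (incr n \<omega> \<bullet> l) - V \<omega> * (cond_drift n \<omega> \<bullet> l)" for \<omega>
    by (simp add: mart_step_def inner_diff_left algebra_simps)
  have intVd: "integrable M (\<lambda>\<omega>. V \<omega> * mart_step n \<omega>)"
    unfolding Vd by (intro Bochner_Integration.integrable_diff integrable_mult_incr integrable_mult_cond_drift VF intV)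
  have zero: "(\<integral>\<omega>. V \<omega> * mart_step n \<omega> \<partial>M) = 0"
    unfolding Vd using integral_incr_inner[OF VF intV, of l] integrable_mult_incr[OF VF intV, of l] integrable_mult_cond_drift[OF VF intV, of l]
    by (subst Bochner_Integration.integral_diff) auto
  have sq: "AE \<omega> in M. (indicator (B n) \<omega> * mart_step n \<omega>)\<^sup>2 \<le> step_bound\<^sup>2"
    using AE_abs_mart_step_le[of n]
  proof eventually_elim
    case (elim \<omega>)
    then have "(mart_step n \<omega>)\<^sup>2 \<le> step_bound\<^sup>2" using abs_le_square_iff[of "mart_step n \<omega>" step_bound] by linarith
    then show ?case by (auto simp: indicator_def)
  qed
  let ?Q = "\<lambda>\<omega>. indicator E \<omega> * (indicator (B n) \<omega> * mart_step n \<omega>)\<^sup>2"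
  have mM: "mart_step n \<in> borel_measurable M" using mart_step_F[of n "Suc n"] measurable_F_imp_M by blast
  have intQ: "integrable M ?Q"
  proof (rule integrable_const_bound[where B = "step_bound\<^sup>2"])
    show "AE \<omega> in M. norm (?Q \<omega>) \<le> step_bound\<^sup>2"
      using sq by eventually_elim (auto simp: indicator_def)
  qed (use EM BM[OF Tn] mM in measurable)
  have leQ: "(\<integral>\<omega>. ?Q \<omega> \<partial>M) \<le> step_bound\<^sup>2 * prob E"
  proof -
    have "(\<integral>\<omega>. ?Q \<omega> \<partial>M) \<le> (\<integral>\<omega>. step_bound\<^sup>2 * indicator E \<omega> \<partial>M)"
    proof (rule integral_mono_AE[OF intQ])
      show "integrable M (\<lambda>\<omega>. step_bound\<^sup>2 * indicat_real E \<omega>)" using EM by (simp add: emeasure_eq_measure)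
      show "AE \<omega> in M. ?Q \<omega> \<le> step_bound\<^sup>2 * indicat_real E \<omega>"
        using sq by eventually_elim (auto simp: indicator_def)
    qed
    then show ?thesis using EM by simp
  qed
  have "W (Suc n) \<omega> = W n \<omega> + indicator (B n) \<omega> * mart_step n \<omega>" for \<omega>
    unfolding W_def using Tn by (rule sum.atLeastLessThan_Suc)
  then have decomp: "indicator E \<omega> * (W (Suc n) \<omega>)\<^sup>2 = indicator E \<omega> * (W n \<omega>)\<^sup>2 + 2 * (V \<omega> * mart_step n \<omega>) + ?Q \<omega>" for \<omega>
    by (simp add: V_def power2_eq_square algebra_simps)
  note IH = Suc.IH[folded n_def]
  have "integrable M (\<lambda>\<omega>. indicator E \<omega> * (W (Suc n) \<omega>)\<^sup>2)"
    unfolding decomp using IH intVd intQ by (intro Bochner_Integration.integrable_add integrable_mult_right) auto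
  moreover have "(\<integral>\<omega>. indicator E \<omega> * (W (Suc n) \<omega>)\<^sup>2 \<partial>M)
      = (\<integral>\<omega>. indicator E \<omega> * (W n \<omega>)\<^sup>2 \<partial>M) + 2 * (\<integral>\<omega>. V \<omega> * mart_step n \<omega> \<partial>M) + (\<integral>\<omega>. ?Q \<omega> \<partial>M)"
    unfolding decomp using IH intVd intQ by simp
  ultimately show ?case
    using IH leQ zero by (simp add: n_def algebra_simps)
qed

text \<open>Kolmogorov's maximal inequality restricted to an event of the past: stop at level x,
  then apply Chebyshev's inequality to the stopped sum.\<close>

lemma prob_mart_exceeds:
  fixes m :: nat
  assumes E: "E \<in> sets (F T)" and x: "x > 0"
  shows "{\<omega> \<in> E. \<exists>k\<in>{T..T + m}. \<bar>mart T k \<omega>\<bar> \<ge> x} \<in> sets M"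
    and "prob {\<omega> \<in> E. \<exists>k\<in>{T..T + m}. \<bar>mart T k \<omega>\<bar> \<ge> x} \<le> m * step_bound\<^sup>2 / x\<^sup>2 * prob E"
proof -
  let ?G = "{\<omega> \<in> E. \<exists>k\<in>{T..T + m}. \<bar>mart T k \<omega>\<bar> \<ge> x}"
  define B where "B k = {\<omega> \<in> space M. \<forall>j\<in>{T..k}. \<bar>mart T j \<omega>\<bar> < x}" for k
  define W where "W n \<omega> = (\<Sum>k=T..<n. indicator (B k) \<omega> * mart_step k \<omega>)" for n \<omega>
  have EM: "E \<in> sets M" using E F_imp_M by blast
  have BF: "B k \<in> sets (F k)" for k
  proof -
    have [measurable]: "mart T j \<in> borel_measurable (F k)" if "j \<in> {T..k}" for j using that by (intro mart_F) auto
    have "{\<omega> \<in> space (F k). \<forall>j\<in>{T..k}. \<bar>mart T j \<omega>\<bar> < x} \<in> sets (F k)" by measurable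
    then show ?thesis by (simp add: B_def space_F)
  qed
  have "?G = E - B (T + m)"
    using sets.sets_into_space[OF EM] by (auto simp: B_def not_less)
  then show G: "?G \<in> sets M" using EM F_imp_M[OF BF] by auto
  have "x\<^sup>2 * prob ?G = (\<integral>\<omega>. x\<^sup>2 * indicator ?G \<omega> \<partial>M)" using G by simp
  also have "\<dots> \<le> (\<integral>\<omega>. indicator E \<omega> * (W (T + m) \<omega>)\<^sup>2 \<partial>M)"
  proof (rule integral_mono)
    show "integrable M (\<lambda>\<omega>. x\<^sup>2 * indicat_real ?G \<omega>)" using G by (simp add: emeasure_eq_measure)
    show "integrable M (\<lambda>\<omega>. indicator E \<omega> * (W (T + m) \<omega>)\<^sup>2)"
      unfolding W_def using integral_stopped_square_le[OF E BF] by blast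
    fix \<omega> assume om: "\<omega> \<in> space M"
    show "x\<^sup>2 * indicat_real ?G \<omega> \<le> indicator E \<omega> * (W (T + m) \<omega>)\<^sup>2"
    proof (cases "\<omega> \<in> ?G")
      case True
      have "W (T + m) \<omega> = (\<Sum>k=T..<T + m. of_bool (\<forall>j\<in>{T..k}. \<bar>mart T j \<omega>\<bar> < x) * mart_step k \<omega>)"
        unfolding W_def using om by (intro sum.cong) (auto simp: B_def indicator_def)
      moreover have nb: "\<not> (\<forall>j\<in>{T..T + m}. \<bar>mart T j \<omega>\<bar> < x)" using True by (auto simp: not_less)
      moreover note stopped_sum_maximal[where S = "\<lambda>n. mart T n \<omega>" and T = T and d = "\<lambda>k. mart_step k \<omega>", OF mart_def x le_add1[of T m]]
      ultimately have "\<bar>W (T + m) \<omega>\<bar> \<ge> x" by (simp only: if_False)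
      then have "x\<^sup>2 \<le> (W (T + m) \<omega>)\<^sup>2" using x abs_le_square_iff[of x "W (T + m) \<omega>"] by simp
      then show ?thesis using True by simp
    qed auto
  qed
  also have "\<dots> \<le> m * step_bound\<^sup>2 * prob E"
    unfolding W_def using integral_stopped_square_le[OF E BF] by blast
  finally show "prob ?G \<le> m * step_bound\<^sup>2 / x\<^sup>2 * prob E" using x by (simp add: field_simps)
qed

section \<open>The initial climb and the decomposition of the height\<close>

definition climb :: "nat \<Rightarrow> 'a set" where
  "climb T = {\<omega> \<in> space M. \<forall>k<T. incr k \<omega> \<bullet> l > r}"

lemma climb_F: "climb T \<in> sets (F T)"
proof -
  have [measurable]: "X k \<in> borel_measurable (F T)" if "k \<le> T" for k using that by (rule X_F)
  have "{\<omega> \<in> space (F T). \<forall>k\<in>{..<T}. incr k \<omega> \<bullet> l > r} \<in> sets (F T)"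
  proof (rule sets.sets_Collect_finite_All)
    fix k assume "k \<in> {..<T}"
    then have [measurable]: "X k \<in> borel_measurable (F T)" "X (Suc k) \<in> borel_measurable (F T)"
      by (auto intro!: X_F)
    show "{\<omega> \<in> space (F T). incr k \<omega> \<bullet> l > r} \<in> sets (F T)" by measurable
  qed auto
  also have "{\<omega> \<in> space (F T). \<forall>k\<in>{..<T}. incr k \<omega> \<bullet> l > r} = climb T"
    unfolding climb_def space_F by auto
  finally show ?thesis .
qed

lemma prob_climb: "prob (climb T) > 0"
proof (induction T)
  case 0
  then show ?case by (simp add: climb_def prob_space)
next
  case (Suc T)
  have "h * prob (climb T) \<le> prob {\<omega> \<in> climb T. incr T \<omega> \<bullet> l > r}"
    using ellipticity_direction[of T] by (intro prob_incr_gt[OF climb_F]) auto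
  also have "{\<omega> \<in> climb T. incr T \<omega> \<bullet> l > r} = climb (Suc T)"
    by (auto simp: climb_def less_Suc_eq)
  finally show ?case using Suc h_pos by (smt (verit) mult_pos_pos)
qed

lemma climb_height: "\<omega> \<in> climb T \<Longrightarrow> k \<le> T \<Longrightarrow> X k \<omega> \<bullet> l \<ge> r * k"
proof (induction k)
  case (Suc k)
  then have "incr k \<omega> \<bullet> l > r" by (auto simp: climb_def)
  then show ?case using Suc by (simp add: inner_diff_left algebra_simps)
qed (auto simp: climb_def start)

text \<open>Doob decomposition of the height: martingale part plus accumulated conditional
  drift.\<close>

lemma height_decomposition:
  "T \<le> n \<Longrightarrow> X n \<omega> \<bullet> l = X T \<omega> \<bullet> l + mart T n \<omega> + (\<Sum>k=T..<n. cond_drift k \<omega> \<bullet> l)"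
proof (induction n rule: dec_induct)
  case (step n)
  then show ?case by (simp add: mart_def mart_step_def inner_diff_left algebra_simps)
qed (simp add: mart_def)

lemma AE_cond_drift_ge:
  "AE \<omega> in M. \<forall>k. cond_drift k \<omega> \<bullet> l \<ge> of_bool (first_visit X k \<omega> \<and> X k \<omega> \<in> A) * lam k"
  using drift no_drift
proof eventually_elim
  case (elim \<omega>)
  show ?case
  proof
    fix k
    show "cond_drift k \<omega> \<bullet> l \<ge> of_bool (first_visit X k \<omega> \<and> X k \<omega> \<in> A) * lam k"
      using elim(1)[rule_format, of k] elim(2)[rule_format, of k]
      by (cases "first_visit X k \<omega> \<and> X k \<omega> \<in> A") (auto simp: cond_drift_def)
  qed
qed

end

context GERW
begin

lemma limit_event: "{\<omega> \<in> space M. filterlim (\<lambda>n. X n \<omega> \<bullet> l) at_top sequentially} \<in> sets M"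
proof -
  have "{\<omega> \<in> space M. filterlim (\<lambda>n. X n \<omega> \<bullet> l) at_top sequentially}
      = {\<omega> \<in> space M. \<forall>b::nat. \<exists>N. \<forall>n. N \<le> n \<longrightarrow> real b \<le> X n \<omega> \<bullet> l}"
  proof (intro Collect_cong conj_cong refl)
    fix \<omega>
    have "(\<forall>b::nat. \<exists>N. \<forall>n. N \<le> n \<longrightarrow> real b \<le> X n \<omega> \<bullet> l) \<Longrightarrow> \<exists>N. \<forall>n\<ge>N. Z \<le> X n \<omega> \<bullet> l" for Z
      using real_arch_simple[of Z] by (meson order.trans)
    then show "filterlim (\<lambda>n. X n \<omega> \<bullet> l) at_top sequentially \<longleftrightarrow> (\<forall>b::nat. \<exists>N. \<forall>n. N \<le> n \<longrightarrow> real b \<le> X n \<omega> \<bullet> l)"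
      unfolding filterlim_at_top eventually_sequentially by blast
  qed
  also have "\<dots> \<in> sets M" by measurable
  finally show ?thesis .
qed

end

section \<open>Escape to infinity\<close>

lemma scale_exists:
  fixes \<alpha> C n\<^sub>0 b :: real
  assumes "\<alpha> > 0"
  obtains j :: nat where "j \<ge> 5" "n\<^sub>0 \<le> 2 ^ j" "b \<le> 2 powr (j * (\<alpha> / 4))"
    "C * (2 powr - \<alpha>) ^ j < 1"
proof -
  have q: "2 powr - \<alpha> < (1::real)" "2 powr (\<alpha> / 4) > (1::real)" using assms by (auto intro: powr_less_one)
  have "(\<lambda>j. C * (2 powr - \<alpha>) ^ j) \<longlonglongrightarrow> C * 0"
    using q by (intro tendsto_mult_left LIMSEQ_realpow_zero) auto
  then have 1: "\<forall>\<^sub>F j in sequentially. C * (2 powr - \<alpha>) ^ j < 1"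
    by (rule order_tendstoD(2)) simp
  obtain a1 where a1: "n\<^sub>0 < 2 ^ a1" using real_arch_pow[of 2 n\<^sub>0] by auto
  obtain a2 where a2: "b < (2 powr (\<alpha> / 4)) ^ a2" using real_arch_pow[OF q(2), of b] by auto
  obtain a3 where a3: "\<And>j. j \<ge> a3 \<Longrightarrow> C * (2 powr - \<alpha>) ^ j < 1"
    using 1 unfolding eventually_sequentially by blast
  define j where "j = Max {5, a1, a2, a3}"
  have j: "j \<ge> 5" "j \<ge> a1" "j \<ge> a2" "j \<ge> a3" by (auto simp: j_def)
  show ?thesis
  proof (rule that[of j])
    have "(2::real) ^ a1 \<le> 2 ^ j" using j by (intro power_increasing) auto
    then show "n\<^sub>0 \<le> 2 ^ j" using a1 by linarith
    have "(2 powr (\<alpha> / 4)) ^ a2 \<le> (2 powr (\<alpha> / 4)) ^ j" using j q by (intro power_increasing) auto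
    also have "\<dots> = 2 powr (j * (\<alpha> / 4))" by (simp add: powr_power)
    finally show "b \<le> 2 powr (j * (\<alpha> / 4))" using a2 by linarith
  qed (use j a3 in auto)
qed

section \<open>Dyadic scales and their bad events\<close>

context GERW_potential
begin

text \<open>With \<theta> = 8 \<alpha>, m = 2^j and N = m^(1/2 + \<alpha>), the bound N^(2 -
  \<theta>) / m has exponent (1/2 + \<alpha>)(2 - \<theta>) - 1 = -2 \<alpha> - 8 \<alpha>^2 in m,
  below the exponent -\<alpha> that the martingale part yields.\<close>

definition \<alpha> :: real where "\<alpha> = \<theta> / 8"

lemma alpha: "0 < \<alpha>" "\<alpha> \<le> 1/16"
  using theta by (auto simp: \<alpha>_def)

definition site_scale :: "nat \<Rightarrow> real" where "site_scale j = 2 powr (j * (1/2 + \<alpha>))"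
definition mart_scale :: "nat \<Rightarrow> real" where "mart_scale j = r / 4 * 2 powr (j * (1/2 + \<alpha> / 2))"

text \<open>The martingale window is twice as long as the one for new sites: at times between 2^j
  and 2^(j+1) after \<open>T\<close>, the drift is collected from the sites found in the first 2^j
  steps.\<close>

definition bad :: "nat \<Rightarrow> nat \<Rightarrow> 'a set" where
  "bad T j = {\<omega> \<in> climb T. real (new_sites T (T + 2 ^ j) \<omega>) < site_scale j}
    \<union> {\<omega> \<in> climb T. \<exists>k\<in>{T..T + 2 ^ Suc j}. \<bar>mart T k \<omega>\<bar> \<ge> mart_scale j}"

text \<open>The factor 32 is 2 from the doubled window times 16 from the square of the 1/4 in
  \<open>mart_scale\<close>.\<close>

definition bad_const :: real where
  "bad_const = 8 * occ_const / return_gain + 32 * step_bound\<^sup>2 / r\<^sup>2"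

lemma climb_M: "climb T \<in> sets M"
  by (rule F_imp_M[OF climb_F])

lemma mart_scale_pos: "mart_scale j > 0"
  using r_pos by (simp add: mart_scale_def)

lemma bad_M: "bad T j \<in> sets M"
  unfolding bad_def
  by (intro sets.Un prob_mart_exceeds(1)[OF climb_F mart_scale_pos] F_imp_M[OF few_new_sites_F[OF climb_F]]) simp

lemma prob_bad_le:
  assumes "j \<ge> 5" "real T \<le> site_scale j"
  shows "prob (bad T j) \<le> bad_const * (2 powr - \<alpha>) ^ j * prob (climb T)"
proof -
  let ?A = "{\<omega> \<in> climb T. real (new_sites T (T + 2 ^ j) \<omega>) < site_scale j}"
  let ?B = "{\<omega> \<in> climb T. \<exists>k\<in>{T..T + 2 ^ Suc j}. \<bar>mart T k \<omega>\<bar> \<ge> mart_scale j}"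
  have q: "(2 powr - \<alpha>) ^ j = 2 powr (- \<alpha> * j)" by (simp add: powr_power mult.commute)
  have pw: "real (2 ^ j) = 2 powr j" by (simp add: powr_realpow)
  have "prob ?A \<le> 8 * occ_const / return_gain * site_scale j powr (2 - \<theta>) / real (2 ^ j) * prob (climb T)"
  proof (rule prob_few_new_sites[OF _ _ assms(2) _ climb_F])
    show "1 \<le> site_scale j" unfolding site_scale_def using alpha by (intro ge_one_powr_ge_zero) auto
    have "sqrt (real (2 ^ j)) = 2 powr (j * (1/2))"
      unfolding pw by (simp add: powr_half_sqrt[symmetric] powr_powr)
    also have "\<dots> \<le> site_scale j" unfolding site_scale_def using alpha by (intro powr_mono mult_left_mono) auto
    finally show "sqrt (real (2 ^ j)) \<le> site_scale j" .
    have "4 * site_scale j = 2 powr (2 + j * (1/2 + \<alpha>))" by (simp add: site_scale_def powr_add)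
    also have "\<dots> \<le> 2 powr j"
    \<comment> \<open>Since \<alpha> \<le> 1/16, it suffices that 2 + 9j/16 \<le> j; the integer
      threshold is j = 5.\<close>
    proof (rule powr_mono)
      have "real j * \<alpha> \<le> real j * (1/16)" using alpha by (intro mult_left_mono) auto
      moreover have "real j \<ge> 5" using assms(1) by simp
      ultimately show "2 + j * (1/2 + \<alpha>) \<le> real j" unfolding distrib_left by linarith
    qed simp
    finally show "4 * site_scale j \<le> real (2 ^ j)" unfolding pw .
  qed
  also have "\<dots> = 8 * occ_const / return_gain * (site_scale j powr (2 - \<theta>) / real (2 ^ j)) * prob (climb T)" by simp
  finally have A: "prob ?A \<le> 8 * occ_const / return_gain * (site_scale j powr (2 - \<theta>) / real (2 ^ j)) * prob (climb T)" .
  have "site_scale j powr (2 - \<theta>) / real (2 ^ j) = 2 powr (j * (1/2 + \<alpha>) * (2 - \<theta>) - j)"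
    by (simp only: pw site_scale_def powr_powr powr_diff[of 2 "j * (1/2 + \<alpha>) * (2 - \<theta>)"])
  also have "\<dots> \<le> 2 powr (- \<alpha> * j)"
  proof (rule powr_mono)
    have t8: "\<theta> = 8 * \<alpha>" by (simp add: \<alpha>_def)
    have "j * (1/2 + \<alpha>) * (2 - \<theta>) - j = - 2 * (\<alpha> * j) - 8 * (\<alpha> * \<alpha> * j)" unfolding t8 by (simp add: algebra_simps)
    also have "\<dots> \<le> - \<alpha> * j"
    proof -
      have "0 \<le> \<alpha> * j" "0 \<le> \<alpha> * \<alpha> * j" using alpha by simp_all
      then show ?thesis unfolding mult_minus_left by linarith
    qed
    finally show "j * (1/2 + \<alpha>) * (2 - \<theta>) - j \<le> - \<alpha> * j" .
  qed simp
  finally have "8 * occ_const / return_gain * (site_scale j powr (2 - \<theta>) / real (2 ^ j)) * prob (climb T)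
      \<le> 8 * occ_const / return_gain * 2 powr (- \<alpha> * j) * prob (climb T)"
    using occ_const_pos return_gain_pos by (intro mult_right_mono mult_left_mono) auto
  with A have A: "prob ?A \<le> 8 * occ_const / return_gain * 2 powr (- \<alpha> * j) * prob (climb T)" by linarith
  have "prob ?B \<le> real (2 ^ Suc j) * step_bound\<^sup>2 / (mart_scale j)\<^sup>2 * prob (climb T)"
    by (rule prob_mart_exceeds(2)[OF climb_F mart_scale_pos])
  also have "real (2 ^ Suc j) * step_bound\<^sup>2 / (mart_scale j)\<^sup>2 = 32 * step_bound\<^sup>2 / r\<^sup>2 * 2 powr (- \<alpha> * j)"
  proof -
    have "(2 powr (j * (1/2 + \<alpha> / 2)))\<^sup>2 = (2::real) powr (j + \<alpha> * j)"
      by (simp add: power2_eq_square powr_add[symmetric] algebra_simps)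
    then have x2: "(mart_scale j)\<^sup>2 = r\<^sup>2 / 16 * (2 powr j * 2 powr (\<alpha> * j))"
      unfolding mart_scale_def power_mult_distrib by (simp add: power_divide powr_add)
    have p2: "real (2 ^ Suc j) = 2 * 2 powr j" by (simp add: powr_realpow)
    show ?thesis unfolding x2 p2 using r_pos by (simp add: powr_minus field_simps)
  qed
  finally have B: "prob ?B \<le> 32 * step_bound\<^sup>2 / r\<^sup>2 * 2 powr (- \<alpha> * j) * prob (climb T)" .
  have "prob (bad T j) \<le> prob ?A + prob ?B"
    unfolding bad_def
    by (intro measure_Un_le prob_mart_exceeds(1)[OF climb_F mart_scale_pos] F_imp_M[OF few_new_sites_F[OF climb_F]]) simp
  with A B show ?thesis unfolding bad_const_def q by (simp add: algebra_simps)
qed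

text \<open>There is a circle to break: the drift at new sites is available only in the half-space,
  and staying there needs the drift. The climb settles the times up to 2^(j0 + 1) after
  \<open>T\<close>, and strong induction on time does the rest.\<close>

lemma good_path_escapes:
  fixes c :: real and j\<^sub>0 n\<^sub>0 T :: nat
  assumes sub: "halfspace_lattice l \<subseteq> A" and c: "c > 0"
    and lam: "\<And>n. n \<ge> 1 \<Longrightarrow> lam n \<ge> c * real (n\<^sub>0 + n) powr (- (\<alpha> / 4))"
    and n0: "real n\<^sub>0 \<le> 2 ^ j\<^sub>0" and b: "3 * (1 + r / 4) / c \<le> 2 powr (j\<^sub>0 * (\<alpha> / 4))"
    and T: "1 \<le> T" "T \<le> 2 ^ j\<^sub>0" "2 * mart_scale j\<^sub>0 \<le> r * T"
    and om: "\<omega> \<in> climb T" and good: "\<And>j. j \<ge> j\<^sub>0 \<Longrightarrow> \<omega> \<notin> bad T j"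
    and dr: "\<And>k. cond_drift k \<omega> \<bullet> l \<ge> of_bool (first_visit X k \<omega> \<and> X k \<omega> \<in> A) * lam k"
  shows "filterlim (\<lambda>n. X n \<omega> \<bullet> l) at_top sequentially"
proof -
  have sp: "\<omega> \<in> space M" using om by (simp add: climb_def)
  have dr0: "cond_drift k \<omega> \<bullet> l \<ge> 0" for k
    using dr[of k] lam_pos[of k] by (smt (verit) of_bool_eq mult_nonneg_nonneg)
  have mart_ge: "mart T (T + k) \<omega> > - mart_scale j" if "j \<ge> j\<^sub>0" "k \<le> 2 ^ Suc j" for j k
  proof -
    have "T + k \<in> {T..T + 2 ^ Suc j}" using that(2) by simp
    then have "\<bar>mart T (T + k) \<omega>\<bar> < mart_scale j"
      using good[OF that(1)] om unfolding bad_def not_le[symmetric] by blast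
    then show ?thesis by linarith
  qed
  have early: "X (T + k) \<omega> \<bullet> l > 0" if "k \<le> 2 ^ Suc j\<^sub>0" for k
  proof -
    have "X T \<omega> \<bullet> l \<ge> r * T" using climb_height[OF om] by simp
    moreover have "(\<Sum>i=T..<T + k. cond_drift i \<omega> \<bullet> l) \<ge> 0" using dr0 by (intro sum_nonneg) auto
    ultimately show ?thesis
      using height_decomposition[of T "T + k" \<omega>] mart_ge[OF order.refl that] T(3) mart_scale_pos[of j\<^sub>0] by linarith
  qed
  \<comment> \<open>Positivity is assumed at earlier times only, which makes this statement the
    induction step.\<close>
  have late: "X (T + k) \<omega> \<bullet> l \<ge> 2 powr (j / 2)"
    if j: "j \<ge> j\<^sub>0" and k: "2 ^ j < k" "k \<le> 2 ^ Suc j" and pos: "\<And>i. i < k \<Longrightarrow> X (T + i) \<omega> \<bullet> l > 0" for j k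
  proof -
    \<comment> \<open>A lower bound for the drift at each new site of the scale:
      \<open>n\<^sub>0\<close>, \<open>T\<close> and the elapsed time are each at most 2^j, so n0 +
      i \<le> 3 * 2^j, and 3^(-\<alpha>/4) \<ge> 1/3.\<close>
    define B where "B = c / 3 * 2 powr (- (j * (\<alpha> / 4)))"
    have B0: "B > 0" using c by (simp add: B_def)
    have pw: "(2::real) ^ j = 2 powr j" by (simp add: powr_realpow)
    have step: "of_bool (first_visit X i \<omega>) * B \<le> cond_drift i \<omega> \<bullet> l" if i: "i \<in> {T..<T + 2 ^ j}" for i
    proof (cases "first_visit X i \<omega>")
      case True
      have "X (T + (i - T)) \<omega> \<bullet> l > 0" using i k by (intro pos) auto
      then have "X i \<omega> \<in> halfspace_lattice l"
        using i lattice_valued[OF sp] by (simp add: halfspace_lattice_def)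
      then have "X i \<omega> \<in> A" using sub by blast
      then have "cond_drift i \<omega> \<bullet> l \<ge> lam i" using dr[of i] True by simp
      moreover have "B \<le> c * real (n\<^sub>0 + i) powr (- (\<alpha> / 4))"
      proof -
        have "(2::real) ^ j\<^sub>0 \<le> 2 ^ j" using j by (intro power_increasing) auto
        moreover have "real i < real T + 2 ^ j"
          using i of_nat_less_iff[of i "T + 2 ^ j", where 'a = real] by simp
        moreover have "real T \<le> 2 ^ j\<^sub>0"
          using T(2) of_nat_le_iff[of T "2 ^ j\<^sub>0", where 'a = real] by simp
        ultimately have "real (n\<^sub>0 + i) \<le> 3 * 2 ^ j" using n0 unfolding of_nat_add by linarith
        moreover have "real (n\<^sub>0 + i) > 0" using i T by simp
        ultimately have "(3 * 2 ^ j) powr (- (\<alpha> / 4)) \<le> real (n\<^sub>0 + i) powr (- (\<alpha> / 4))"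
          using alpha by (intro powr_mono2') auto
        moreover have "(3 * 2 ^ j :: real) powr (- (\<alpha> / 4)) = 3 powr (- (\<alpha> / 4)) * 2 powr (- (j * (\<alpha> / 4)))"
          unfolding pw by (simp add: powr_mult powr_powr)
        moreover have "(3::real) powr (-1) \<le> 3 powr (- (\<alpha> / 4))" using alpha by (intro powr_mono) auto
        then have "1 / 3 * 2 powr (- (j * (\<alpha> / 4))) \<le> 3 powr (- (\<alpha> / 4)) * 2 powr (- (j * (\<alpha> / 4)))"
          by (intro mult_right_mono) (auto simp: powr_minus field_simps)
        ultimately have "1 / 3 * 2 powr (- (j * (\<alpha> / 4))) \<le> real (n\<^sub>0 + i) powr (- (\<alpha> / 4))" by linarith
        then have "c * (1 / 3 * 2 powr (- (j * (\<alpha> / 4)))) \<le> c * real (n\<^sub>0 + i) powr (- (\<alpha> / 4))"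
          using c by (intro mult_left_mono) auto
        then show ?thesis by (simp add: B_def)
      qed
      moreover have "lam i \<ge> c * real (n\<^sub>0 + i) powr (- (\<alpha> / 4))" using i T by (intro lam) auto
      ultimately show ?thesis using True by simp
    qed (use dr0 in simp)
    have "site_scale j * B \<le> real (new_sites T (T + 2 ^ j) \<omega>) * B"
      using good[OF j] om B0 unfolding bad_def by (intro mult_right_mono) (auto simp: not_less)
    also have "\<dots> = (\<Sum>i=T..<T + 2 ^ j. of_bool (first_visit X i \<omega>) * B)"
      by (simp add: new_sites_def sum_distrib_right[symmetric] of_bool_def sum.inter_filter[symmetric])
    also have "\<dots> \<le> (\<Sum>i=T..<T + 2 ^ j. cond_drift i \<omega> \<bullet> l)" by (intro sum_mono step)
    also have "\<dots> \<le> (\<Sum>i=T..<T + k. cond_drift i \<omega> \<bullet> l)"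
      using k dr0 by (intro sum_mono2) auto
    finally have "site_scale j * B \<le> (\<Sum>i=T..<T + k. cond_drift i \<omega> \<bullet> l)" .
    moreover have "X T \<omega> \<bullet> l \<ge> 0" using climb_height[OF om order.refl] r_pos by (smt (verit) mult_nonneg_nonneg of_nat_0_le_iff)
    ultimately have "X (T + k) \<omega> \<bullet> l \<ge> site_scale j * B - mart_scale j"
      using height_decomposition[of T "T + k" \<omega>] mart_ge[OF j k(2)] by simp
    moreover have "site_scale j * B - mart_scale j \<ge> 2 powr (j / 2)"
    proof -
      \<comment> \<open>The drift has exponent 1/2 + \<alpha> - \<alpha>/4, which is the martingale
        exponent 1/2 + \<alpha>/2 plus \<alpha>/4. The surplus factor 2^(j \<alpha>/4) pays for the
        constants c and r and leaves one full \<open>z\<close>.\<close>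
      define z where "z = (2::real) powr (j * (1/2 + \<alpha> / 2))"
      have "site_scale j * B = c / 3 * (2 powr (j * (1/2 + \<alpha>)) * 2 powr (- (j * (\<alpha> / 4))))"
        by (simp add: site_scale_def B_def)
      also have "\<dots> = c / 3 * (z * 2 powr (j * (\<alpha> / 4)))"
        unfolding z_def powr_add[symmetric] by (simp add: algebra_simps)
      finally have NB: "site_scale j * B = z * (c / 3 * 2 powr (j * (\<alpha> / 4)))" by simp
      have "3 * (1 + r / 4) / c \<le> 2 powr (j * (\<alpha> / 4))"
      proof -
        have "(2::real) powr (j\<^sub>0 * (\<alpha> / 4)) \<le> 2 powr (j * (\<alpha> / 4))"
          using j alpha by (intro powr_mono mult_right_mono) auto
        then show ?thesis using b by linarith
      qed
      then have "1 + r / 4 \<le> c / 3 * 2 powr (j * (\<alpha> / 4))" using c by (simp add: field_simps)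
      then have "z * (1 + r / 4) \<le> site_scale j * B" unfolding NB by (intro mult_left_mono) (auto simp: z_def)
      moreover have "mart_scale j = z * (r / 4)" by (simp add: mart_scale_def z_def)
      moreover have "2 powr (j / 2) \<le> z" unfolding z_def
        using alpha by (intro powr_mono) (auto simp: algebra_simps)
      ultimately show ?thesis by (simp add: algebra_simps)
    qed
    ultimately show ?thesis by linarith
  qed
  have scale: "\<exists>j\<ge>j\<^sub>0. 2 ^ j < k \<and> k \<le> 2 ^ Suc j" if k: "k > 2 ^ Suc j\<^sub>0" for k :: nat
  proof -
    have "(1::nat) \<le> 2 ^ j\<^sub>0" by simp
    then have "k \<ge> 2" using k unfolding power_Suc by linarith
    then obtain j where j: "2 ^ j < k" "k \<le> 2 ^ (j + 1)" using ex_power_ivl2[of 2 k] by auto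
    from order.strict_trans2[OF k j(2)] have "j\<^sub>0 < j" by simp
    then show ?thesis using j by (intro exI[of _ j]) auto
  qed
  have pos: "X (T + k) \<omega> \<bullet> l > 0" for k
  proof (induction k rule: less_induct)
    case (less k)
    show ?case
    proof (cases "k \<le> 2 ^ Suc j\<^sub>0")
      case False
      then obtain j where "j \<ge> j\<^sub>0" "2 ^ j < k" "k \<le> 2 ^ Suc j" using scale[of k] by auto
      then show ?thesis using late[OF _ _ _ less.IH] by (smt (verit) powr_gt_zero)
    qed (rule early)
  qed
  have lower: "X (T + k) \<omega> \<bullet> l \<ge> sqrt (k / 2)" if k: "k > 2 ^ Suc j\<^sub>0" for k
  proof -
    obtain j where j: "j \<ge> j\<^sub>0" "2 ^ j < k" "k \<le> 2 ^ Suc j" using scale[OF k] by auto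
    have "real k \<le> 2 * 2 ^ j" using j(3) of_nat_le_iff[of k "2 ^ Suc j", where 'a = real] by simp
    then have "sqrt (k / 2) \<le> sqrt (2 ^ j)" by (intro real_sqrt_le_mono) simp
    also have "\<dots> = 2 powr (j / 2)" by (simp add: powr_half_sqrt[symmetric] powr_powr flip: powr_realpow)
    finally show ?thesis using late[OF j pos] by linarith
  qed
  have "filterlim (\<lambda>k::nat. sqrt (k / 2)) at_top sequentially"
    by (intro filterlim_compose[OF sqrt_at_top] filterlim_at_top_mult_tendsto_pos[where c = "1/2" and f = "\<lambda>_. 1/2" and g = real, simplified]
        filterlim_real_sequentially) 
  then have "filterlim (\<lambda>k. X (T + k) \<omega> \<bullet> l) at_top sequentially"
    by (rule filterlim_at_top_mono) (use lower in \<open>auto simp: eventually_at_top_dense\<close>)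
  then show ?thesis
    unfolding filterlim_at_top add.commute[of T]
    by (simp add: eventually_sequentially_seg[where P = "\<lambda>n. _ \<le> X n \<omega> \<bullet> l"])
qed

text \<open>Union bound over all scales from \<open>j\<^sub>0\<close> on. There is no circularity:
  \<open>j\<^sub>0\<close> is chosen first, the length \<open>T\<close> of the climb is computed
  from it, and \<open>bad_const\<close> does not depend on \<open>T\<close>.\<close>

lemma prob_escape_pos:
  fixes c :: real
  assumes sub: "halfspace_lattice l \<subseteq> A" and c: "c > 0"
    and lam: "\<And>n. n \<ge> 1 \<Longrightarrow> lam n \<ge> c * real (n\<^sub>0 + n) powr (- (\<alpha> / 4))"
  shows "prob {\<omega> \<in> space M. filterlim (\<lambda>n. X n \<omega> \<bullet> l) at_top sequentially} > 0"
proof -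
  define q :: real where "q = 2 powr - \<alpha>"
  have q: "0 < q" "q < 1" using alpha by (auto simp: q_def intro: powr_less_one)
  obtain j\<^sub>0 where j0: "j\<^sub>0 \<ge> 5" "real n\<^sub>0 \<le> 2 ^ j\<^sub>0" "3 * (1 + r / 4) / c \<le> 2 powr (j\<^sub>0 * (\<alpha> / 4))"
      "bad_const / (1 - q) * q ^ j\<^sub>0 < 1"
    using scale_exists[OF alpha(1), of "real n\<^sub>0" "3 * (1 + r / 4) / c" "bad_const / (1 - q)"] unfolding q_def by blast
  \<comment> \<open>the climb must reach twice the fluctuations on scale \<open>j\<^sub>0\<close>, yet last for fewer steps than the
      number of new sites on that scale\<close>
  define y :: real where "y = 2 powr (j\<^sub>0 * (1/2 + \<alpha> / 2))"
  define T where "T = nat \<lfloor>y\<rfloor>"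
  have y1: "y \<ge> 1" unfolding y_def using alpha by (intro ge_one_powr_ge_zero) auto
  have T: "real T \<le> y" "y < real T + 1" using y1 unfolding T_def by linarith+
  have T1: "1 \<le> T" using T y1 by linarith
  have T2: "2 * mart_scale j\<^sub>0 \<le> r * T"
  proof -
    \<comment> \<open>From T \<ge> 1 one gets y < T + 1 \<le> 2T, so rounding down loses at most a
      factor 2.\<close>
    have "y / 2 \<le> T" using T T1 by linarith
    then have "r * (y / 2) \<le> r * T" using r_pos by (intro mult_left_mono) auto
    then show ?thesis by (simp add: mart_scale_def y_def)
  qed
  have TN: "real T \<le> site_scale j" if "j \<ge> j\<^sub>0" for j
  proof -
    have "y \<le> site_scale j" unfolding y_def site_scale_def using that alpha by (intro powr_mono mult_mono) auto
    then show ?thesis using T by linarith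
  qed
  have T3: "T \<le> 2 ^ j\<^sub>0"
  proof -
    have "y \<le> 2 powr j\<^sub>0" unfolding y_def
      using alpha mult_left_mono[of "1/2 + \<alpha> / 2" 1 "real j\<^sub>0"] by (intro powr_mono) auto
    then have "real T \<le> 2 ^ j\<^sub>0" using T(1) powr_realpow[of 2 j\<^sub>0] by linarith
    then show ?thesis by simp
  qed
  define U where "U = (\<Union>i. bad T (j\<^sub>0 + i))"
  have UM: "U \<in> sets M" unfolding U_def using bad_M by auto
  have pb: "prob (bad T (j\<^sub>0 + i)) \<le> bad_const * prob (climb T) * q ^ j\<^sub>0 * q ^ i" for i
    using prob_bad_le[of "j\<^sub>0 + i" T] j0(1) TN[of "j\<^sub>0 + i"]
    by (simp add: q_def power_add mult.assoc mult.left_commute mult.commute)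
  have geo: "(\<lambda>i. bad_const * prob (climb T) * q ^ j\<^sub>0 * q ^ i) sums (bad_const * prob (climb T) * q ^ j\<^sub>0 * (1 / (1 - q)))"
    using q by (intro sums_mult geometric_sums) auto
  have summ: "summable (\<lambda>i. prob (bad T (j\<^sub>0 + i)))"
    using pb by (intro summable_comparison_test'[OF sums_summable[OF geo]]) auto
  have "prob U \<le> (\<Sum>i. prob (bad T (j\<^sub>0 + i)))"
    unfolding U_def using bad_M by (intro finite_measure_subadditive_countably summ) auto
  also have "\<dots> \<le> bad_const * prob (climb T) * q ^ j\<^sub>0 * (1 / (1 - q))"
    using suminf_le[OF pb summ sums_summable[OF geo]] sums_unique[OF geo] by simp
  also have "\<dots> = bad_const / (1 - q) * q ^ j\<^sub>0 * prob (climb T)" by simp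
  \<comment> \<open>Both sides carry the factor \<open>prob (climb T)\<close>; only its positivity
    is used, however small it is.\<close>
  also have "\<dots> < 1 * prob (climb T)" using j0(4) prob_climb by (intro mult_strict_right_mono)
  finally have "prob U < prob (climb T)" by simp
  moreover have "U \<subseteq> climb T" by (auto simp: U_def bad_def)
  ultimately have "0 < prob (climb T - U)"
    using finite_measure_Diff[OF climb_M UM] by simp
  also have "\<dots> \<le> prob {\<omega> \<in> space M. filterlim (\<lambda>n. X n \<omega> \<bullet> l) at_top sequentially}"
  proof (rule finite_measure_mono_AE[OF _ limit_event])
    show "AE \<omega> in M. \<omega> \<in> climb T - U \<longrightarrow> \<omega> \<in> {\<omega> \<in> space M. filterlim (\<lambda>n. X n \<omega> \<bullet> l) at_top sequentially}"
      using AE_cond_drift_ge AE_space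
    proof eventually_elim
      case (elim \<omega>)
      show ?case
      proof
        assume om: "\<omega> \<in> climb T - U"
        have "\<omega> \<notin> bad T j" if "j \<ge> j\<^sub>0" for j
          using om that unfolding U_def by (metis DiffD2 UN_I UNIV_I le_Suc_ex)
        with om elim show "\<omega> \<in> {\<omega> \<in> space M. filterlim (\<lambda>n. X n \<omega> \<bullet> l) at_top sequentially}"
          using good_path_escapes[OF sub c lam j0(2,3) T1 T3 T2] by blast
      qed
    qed
  qed
  finally show ?thesis .
qed

end

theorem theorem1p1:
  fixes l :: "real ^ 'd" and K h r :: real
  assumes "CARD('d) \<ge> 2" and "norm l = 1" and "K > 0" and "h > 0" and "r > 0"
  shows "\<exists>\<beta>\<^sub>0::real. 0 < \<beta>\<^sub>0 \<and> \<beta>\<^sub>0 < 1/6 \<and>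
    (\<forall>(M :: 'a measure) (F :: nat \<Rightarrow> 'a measure) (lam :: nat \<Rightarrow> real) (A :: (real ^ 'd) set)
      (X :: nat \<Rightarrow> 'a \<Rightarrow> real ^ 'd).
      GERW M F l lam A K h r X \<and> halfspace_lattice l \<subseteq> A \<longrightarrow>
      (\<forall>(n\<^sub>0::nat) (c::real) (\<beta>::real).
        c > 0 \<and> \<beta> < \<beta>\<^sub>0 \<and> (\<forall>n\<ge>1. lam n \<ge> c * real (n\<^sub>0 + n) powr (-\<beta>)) \<longrightarrow>
        measure M {\<omega> \<in> space M. filterlim (\<lambda>n. X n \<omega> \<bullet> l) at_top sequentially} > 0))"
proof -
  define \<eta> where "\<eta> = h * r\<^sup>2 / 2"
  have "\<eta> > 0" using assms by (simp add: \<eta>_def)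
  then obtain p R :: real where p: "0 < p" "p < 1/2" and R: "R \<ge> 1" and step:
    "\<And>y D e :: real ^ 'd. norm D \<le> K \<Longrightarrow> norm e = 1 \<Longrightarrow> e \<bullet> y = 0 \<Longrightarrow>
      (R\<^sup>2 + (norm (y + D))\<^sup>2) powr p - (R\<^sup>2 + (norm y)\<^sup>2) powr p
        \<ge> p * (R\<^sup>2 + (norm y)\<^sup>2) powr (p - 1) * (2 * (y \<bullet> D) + (e \<bullet> D)\<^sup>2 - \<eta>)"
    using power_potential_step[OF _ assms(3), where 'v = "real ^ 'd"] by metis
  \<comment> \<open>This is \<alpha>/4 written out, before any process is introduced: it depends
    only on p, hence on K, h, r, and on the dimension.\<close>
  define \<beta>\<^sub>0 where "\<beta>\<^sub>0 = (1 - 2 * p) / (2 * CARD('d)) / 8 / 4"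
  have "1 - 2 * p < real CARD('d)" using p assms(1) by linarith
  then have b: "0 < \<beta>\<^sub>0" "\<beta>\<^sub>0 < 1/6" using p assms(1) by (auto simp: \<beta>\<^sub>0_def field_simps)
  have main: "measure M {\<omega> \<in> space M. filterlim (\<lambda>n. X n \<omega> \<bullet> l) at_top sequentially} > 0"
    if G: "GERW M F l lam A K h r X" and sub: "halfspace_lattice l \<subseteq> A"
      and c: "c > 0" and beta: "\<beta> < \<beta>\<^sub>0" and lam: "\<forall>n\<ge>1. lam n \<ge> c * real (n\<^sub>0 + n) powr (-\<beta>)"
    for M :: "'a measure" and F lam A X n\<^sub>0 c \<beta>
  proof -
    interpret GERW M F l lam A K h r X by (rule G)
    interpret GERW_potential M F l lam A K h r X p R "h * r\<^sup>2 / 2"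
      by unfold_locales (use p R step in \<open>auto simp: \<eta>_def\<close>)
    have al: "\<alpha> / 4 = \<beta>\<^sub>0" by (simp add: \<alpha>_def \<theta>_def \<beta>\<^sub>0_def)
    show ?thesis
    proof (rule prob_escape_pos[OF sub c])
      fix n :: nat assume n: "n \<ge> 1"
      \<comment> \<open>The base is at least 1, so decreasing the exponent \<beta> only strengthens
        the lower bound on \<open>lam\<close>; negative \<beta> is covered too.\<close>
      have "real (n\<^sub>0 + n) powr (- (\<alpha> / 4)) \<le> real (n\<^sub>0 + n) powr (- \<beta>)"
        unfolding al using n beta by (intro powr_mono) auto
      then have "c * real (n\<^sub>0 + n) powr (- (\<alpha> / 4)) \<le> c * real (n\<^sub>0 + n) powr (- \<beta>)"
        using c by (intro mult_left_mono) auto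
      then show "lam n \<ge> c * real (n\<^sub>0 + n) powr (- (\<alpha> / 4))" using lam n by fastforce
    qed
  qed
  then show ?thesis using b by blast
qed

end
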